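(* Let $f:\mathbb{S}^n\to\mathbb{R}$ be convex, let $X_\star=R_\star R_\star^\top$ with $R_\star\in\mathbb{R}^{n\times r_\star}$ of full column rank be the unique minimizer of the semidefinite problem of minimizing $f(X)$ subject to $\mathcal{A}(X)=b$, $X\succeq0$, and suppose the assumptions Smoothness, Dual optimum, Rank-$r$ quadratic growth with $r=r_\star$ and constant $\alpha_f>0$, and Rank-$r$ constraint qualification with $r=r_\star$ (all listed in the context) hold. Then there are constants $\ell<5$ and $\widetilde\ell<\dfrac{2(\sqrt2+1)\,\ell}{\sigma_{r_\star}(R_\star)^2\alpha_f}$ such that for all sufficiently large $\lambda$, the function $\varphi(R)=f(RR^\top)+\lambda\|\mathcal{A}(RR^\top)-b\|_2$ on $\mathbb{R}^{n\times r_\star}$ satisfies, for all $R$ in a neighborhood of $S=\{R\in\mathbb{R}^{n\times r_\star}:RR^\top=X_\star\}$, $$\varphi(R)-\varphi_\star\le\ell\cdot\mathrm{dist}(0,\partial\varphi(R))\cdot\mathrm{dist}(R,S)\qquad\text{(norm convexity)}$$ and $$\mathrm{dist}(R,S)\le\widetilde\ell\cdot\mathrm{dist}(0,\partial\varphi(R))\qquad\text{(sub-differential regularity)},$$ where $\varphi_\star=f(X_\star)$ is the value of $\varphi$ on $S$.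
   Context: $\mathbb{S}^n$ is the space of symmetric $n\times n$ matrices with the Frobenius inner product and norm $\|\cdot\|_F$. $\mathcal{A}:\mathbb{S}^n\to\mathbb{R}^k$, $[\mathcal{A}(X)]_i=\langle A_i,X\rangle$ with $A_i\in\mathbb{S}^n$; $b\in\mathbb{R}^k$. $\sigma_i(\cdot)$ denotes the $i$-th largest singular value. $\mathrm{dist}(R,S)=\min_{R'\in S}\|R-R'\|_F$. Sub-differential: with $h(X)=f(X)+\lambda\|\mathcal{A}(X)-b\|_2$, so $\varphi(R)=h(RR^\top)$, $\partial\varphi(R)=\{2GR:G\in\partial h(RR^\top)\}$, and $\mathrm{dist}(0,\cdot)$ is taken in Frobenius norm. Smoothness. $f\in C^2$, $\|\nabla^2f(X)\|_{\mathrm{op}}\le\beta_f$ and $\|\nabla^2f(X_1)-\nabla^2f(X_2)\|_{\mathrm{op}}\le\rho_f\|X_1-X_2\|_F$ for all $X,X_1,X_2\succeq0$; $f$ is $L_f$-Lipschitz near $X_\star$. Dual optimum. There exist $y_\star\in\mathbb{R}^k$ and $Z_\star\succeq0$ with $\nabla f(X_\star)+\sum_{i=1}^k(y_\star)_iA_i-Z_\star=0$ and $\langle Z_\star,X_\star\rangle=0$. Rank-$r$ quadratic growth with constant $\alpha_f$. There is $\varepsilon>0$ such that $f(X)\ge f(X_\star)+\frac{\alpha_f}{2}\|X-X_\star\|_F^2$ for all $X\succeq0$ with $\mathcal{A}(X)=b$, $\mathrm{rank}(X)\le r$ and $\|X-X_\star\|_F\le\varepsilon$. Rank-$r$ constraint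 qualification. $\mathcal{M}_r=\{R\in\mathbb{R}^{n\times r}:\mathcal{A}(RR^\top)=b\}$ is a smooth manifold, and there is $\gamma>0$ such that $\sigma_{\min}(M_R)\ge\gamma$ for all $R$ in a neighborhood of $\{R\in\mathbb{R}^{n\times r}:RR^\top=X_\star\}$, where $M_R=[\mathrm{vec}(A_1R)\ \cdots\ \mathrm{vec}(A_kR)]\in\mathbb{R}^{nr\times k}$ and $\sigma_{\min}$ is the $k$-th largest singular value. *)

theory Defs
  imports "HOL-Analysis.Analysis"
begin

text \<open>
  On \<open>real^'n^'m\<close> the library inner product and norm are the Frobenius ones.
  The space of symmetric matrices is treated as a linear subspace of \<open>real^'n^'n\<close>, so a
  function on it is only ever evaluated there, and its derivatives are taken within it.
\<close>

definition sym_mats :: "(real^'n^'n) set" where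
  "sym_mats = {X. transpose X = X}"

definition psd :: "real^'n^'n \<Rightarrow> bool" where
  "psd X \<longleftrightarrow> X \<in> sym_mats \<and> (\<forall>v. 0 \<le> v \<bullet> (X *v v))"

definition gram :: "real^'r^'n \<Rightarrow> real^'n^'n" where
  "gram R = R ** transpose R"

definition meas_map :: "('k \<Rightarrow> real^'n^'n) \<Rightarrow> real^'n^'n \<Rightarrow> real^'k" where
  "meas_map A X = (\<chi> i. A i \<bullet> X)"

text \<open>
  The multiplicity of a singular value \<open>s\<close> of \<open>M\<close> is the dimension of the eigenspace of
  \<open>M\<^sup>T M\<close> for \<open>s\<^sup>2\<close>. Zero singular values are included, so there are as many singular
  values as \<open>M\<close> has columns. The index of \<open>singular_value\<close> starts at 1.
\<close>

definition sv_space :: "real^'c^'m \<Rightarrow> real \<Rightarrow> (real^'c) set" where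
  "sv_space M s = {v. (transpose M ** M) *v v = s\<^sup>2 *\<^sub>R v}"

definition sv_set :: "real^'c^'m \<Rightarrow> real set" where
  "sv_set M = {s. 0 \<le> s \<and> (\<exists>v. v \<noteq> 0 \<and> v \<in> sv_space M s)}"

definition singular_values :: "real^'c^'m \<Rightarrow> real list" where
  "singular_values M =
     rev (concat (map (\<lambda>s. replicate (dim (sv_space M s)) s) (sorted_list_of_set (sv_set M))))"

definition singular_value :: "nat \<Rightarrow> real^'c^'m \<Rightarrow> real" where
  "singular_value i M = singular_values M ! (i - 1)"

text \<open>Intended for open \<open>U\<close>, where \<open>frechet_derivative f (at x)\<close> is the derivative on \<open>U\<close>.\<close>

primrec Ck_on :: "nat \<Rightarrow> 'a::real_normed_vector set \<Rightarrow> ('a \<Rightarrow> 'b::real_normed_vector) \<Rightarrow> bool"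
where
  "Ck_on 0 U f \<longleftrightarrow> continuous_on U f"
| "Ck_on (Suc k) U f \<longleftrightarrow>
     (\<forall>x\<in>U. f differentiable (at x)) \<and> (\<forall>v. Ck_on k U (\<lambda>x. frechet_derivative f (at x) v))"

definition smooth_on :: "'a::real_normed_vector set \<Rightarrow> ('a \<Rightarrow> 'b::real_normed_vector) \<Rightarrow> bool" where
  "smooth_on U f \<longleftrightarrow> (\<forall>k. Ck_on k U f)"

text \<open>Embedded submanifolds of constant dimension \<open>d\<close>, via local straightening diffeomorphisms.\<close>

definition smooth_submanifold :: "'a::euclidean_space set \<Rightarrow> bool" where
  "smooth_submanifold M \<longleftrightarrow>
     (\<exists>d. \<forall>p\<in>M. \<exists>U V \<phi> \<psi> (L :: 'a set).
        open U \<and> p \<in> U \<and> open V \<and> homeomorphism U V \<phi> \<psi> \<and> smooth_on U \<phi> \<and> smooth_on V \<psi> \<and>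
        subspace L \<and> dim L = d \<and> \<phi> ` (U \<inter> M) = V \<inter> L)"

definition feasible :: "('k \<Rightarrow> real^'n^'n) \<Rightarrow> real^'k \<Rightarrow> real^'n^'n \<Rightarrow> bool" where
  "feasible A b X \<longleftrightarrow> psd X \<and> meas_map A X = b"

text \<open>Operator norm of the restriction of \<open>T\<close> to the symmetric matrices; cf. \<open>onorm\<close>.\<close>

definition sym_onorm :: "(real^'n^'n \<Rightarrow> real^'n^'n) \<Rightarrow> real" where
  "sym_onorm T = (SUP H\<in>sym_mats. norm (T H) / norm H)"

text \<open>
  \<open>f\<close> is twice continuously differentiable on the symmetric matrices, with gradient \<open>g\<close> and
  Hessian \<open>H\<close>. The values of \<open>H X\<close> off the symmetric matrices are irrelevant.
\<close>

definition C2_sym ::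
  "(real^'n^'n \<Rightarrow> real) \<Rightarrow> (real^'n^'n \<Rightarrow> real^'n^'n) \<Rightarrow> (real^'n^'n \<Rightarrow> real^'n^'n \<Rightarrow> real^'n^'n) \<Rightarrow> bool"
where
  "C2_sym f g H \<longleftrightarrow>
     (\<forall>X\<in>sym_mats. g X \<in> sym_mats \<and>
        (f has_derivative (\<lambda>D. g X \<bullet> D)) (at X within sym_mats) \<and>
        (g has_derivative H X) (at X within sym_mats) \<and>
        ((\<lambda>Y. sym_onorm (\<lambda>D. H Y D - H X D)) \<longlongrightarrow> 0) (at X within sym_mats))"

definition smoothness ::
  "(real^'n^'n \<Rightarrow> real) \<Rightarrow> (real^'n^'n \<Rightarrow> real^'n^'n) \<Rightarrow> (real^'n^'n \<Rightarrow> real^'n^'n \<Rightarrow> real^'n^'n) \<Rightarrow>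
   real^'n^'n \<Rightarrow> real \<Rightarrow> real \<Rightarrow> real \<Rightarrow> bool"
where
  "smoothness f g H Xs \<beta> \<rho> L \<longleftrightarrow>
     C2_sym f g H \<and>
     (\<forall>X. psd X \<longrightarrow> sym_onorm (H X) \<le> \<beta>) \<and>
     (\<forall>X Y. psd X \<longrightarrow> psd Y \<longrightarrow> sym_onorm (\<lambda>D. H X D - H Y D) \<le> \<rho> * norm (X - Y)) \<and>
     (\<exists>\<epsilon>>0. L-lipschitz_on (ball Xs \<epsilon> \<inter> sym_mats) f)"

definition dual_optimum ::
  "('k::finite \<Rightarrow> real^'n^'n) \<Rightarrow> (real^'n^'n \<Rightarrow> real^'n^'n) \<Rightarrow> real^'n^'n \<Rightarrow> bool"
where
  "dual_optimum A g Xs \<longleftrightarrow>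
     (\<exists>(y::real^'k) Z. psd Z \<and> g Xs + (\<Sum>i\<in>UNIV. (y $ i) *\<^sub>R A i) - Z = 0 \<and> Z \<bullet> Xs = 0)"

definition quadratic_growth ::
  "nat \<Rightarrow> (real^'n^'n \<Rightarrow> real) \<Rightarrow> ('k \<Rightarrow> real^'n^'n) \<Rightarrow> real^'k \<Rightarrow> real^'n^'n \<Rightarrow> real \<Rightarrow> bool"
where
  "quadratic_growth r f A b Xs \<alpha> \<longleftrightarrow>
     (\<exists>\<epsilon>>0. \<forall>X. feasible A b X \<longrightarrow> rank X \<le> r \<longrightarrow> norm (X - Xs) \<le> \<epsilon> \<longrightarrow>
        f X \<ge> f Xs + \<alpha> / 2 * (norm (X - Xs))\<^sup>2)"

definition factor_set :: "real^'n^'n \<Rightarrow> (real^'r^'n) set" where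
  "factor_set Xs = {R. gram R = Xs}"

text \<open>The matrix with columns \<open>vec (A\<^sub>l R)\<close>; its rows are indexed by the positions \<open>(i, j)\<close>.\<close>

definition cq_matrix :: "('k \<Rightarrow> real^'n^'n) \<Rightarrow> real^'r^'n \<Rightarrow> real^'k^('n \<times> 'r)" where
  "cq_matrix A R = (\<chi> p l. (A l ** R) $ fst p $ snd p)"

definition constraint_qualification ::
  "'r::finite itself \<Rightarrow> ('k::finite \<Rightarrow> real^'n^'n) \<Rightarrow> real^'k \<Rightarrow> real^'n^'n \<Rightarrow> bool"
where
  "constraint_qualification _ A b Xs \<longleftrightarrow>
     smooth_submanifold {R :: real^'r^'n. meas_map A (gram R) = b} \<and>
     (\<exists>\<gamma>>0. \<exists>U. open U \<and> (factor_set Xs :: (real^'r^'n) set) \<subseteq> U \<and>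
        (\<forall>R\<in>U. singular_value CARD('k) (cq_matrix A R) \<ge> \<gamma>))"

definition penalized ::
  "(real^'n^'n \<Rightarrow> real) \<Rightarrow> ('k::finite \<Rightarrow> real^'n^'n) \<Rightarrow> real^'k \<Rightarrow> real \<Rightarrow> real^'n^'n \<Rightarrow> real"
where
  "penalized f A b lam X = f X + lam * norm (meas_map A X - b)"

definition objective ::
  "(real^'n^'n \<Rightarrow> real) \<Rightarrow> ('k::finite \<Rightarrow> real^'n^'n) \<Rightarrow> real^'k \<Rightarrow> real \<Rightarrow> real^'r^'n \<Rightarrow> real"
where
  "objective f A b lam R = penalized f A b lam (gram R)"

text \<open>Convex subdifferential of a function on the symmetric matrices.\<close>

definition sym_subdiff :: "(real^'n^'n \<Rightarrow> real) \<Rightarrow> real^'n^'n \<Rightarrow> (real^'n^'n) set" where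
  "sym_subdiff h X = {G \<in> sym_mats. \<forall>Y\<in>sym_mats. h Y \<ge> h X + G \<bullet> (Y - X)}"

definition objective_subdiff ::
  "(real^'n^'n \<Rightarrow> real) \<Rightarrow> ('k::finite \<Rightarrow> real^'n^'n) \<Rightarrow> real^'k \<Rightarrow> real \<Rightarrow> real^'r^'n \<Rightarrow> (real^'r^'n) set"
where
  "objective_subdiff f A b lam R =
     (\<lambda>G. 2 *\<^sub>R (G ** R)) ` sym_subdiff (penalized f A b lam) (gram R)"

end

theory Submission
  imports Defs
begin

text \<open>
  Let \<open>h\<close> be the penalized function, so that the objective at \<open>R\<close> is \<open>h (R R\<^sup>T)\<close>. Let \<open>X = R R\<^sup>T\<close> be near \<open>Xs\<close>, let \<open>Rh\<close> be the factor of \<open>Xs\<close> nearest to \<open>R\<close>, and put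
  \<open>De = R - Rh\<close>, \<open>\<delta> = \<parallel>De\<parallel> = dist(R, S)\<close>. An element of the subdifferential at \<open>R\<close> is
  \<open>d = 2 G R\<close> with \<open>G = g X + \<Sum>\<^sub>i v\<^sub>i A\<^sub>i\<close> (\<open>sym_subdiff_penalized_representation\<close>). Since \<open>h\<close> is convex,
  the subgradient inequality at \<open>Xs\<close> and \<open>X - Xs = R De\<^sup>T + De R\<^sup>T - De De\<^sup>T\<close> give
  \<open>h X - h Xs \<le> \<langle>d, De\<rangle> - \<langle>G, De De\<^sup>T\<rangle> \<le> \<parallel>d\<parallel> \<delta> - \<langle>G, De De\<^sup>T\<rangle>\<close>.

  The last term is of higher order, although \<open>G\<close> itself may grow with the penalty parameter.
  By the dual optimum, \<open>G = (g X - g Xs) + Z + \<Sum>\<^sub>i w\<^sub>i A\<^sub>i\<close> with \<open>w = v - y\<close> and \<open>Z\<close> positive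
  semidefinite with \<open>Z Rh = 0\<close>. So \<open>Z\<close> contributes with the good sign, \<open>g X - g Xs\<close> is of order
  \<open>\<delta>\<close>, and multiplying by \<open>R\<close> and using the constraint qualification bounds \<open>w\<close> by
  \<open>\<parallel>w\<parallel> \<le> (\<parallel>d\<parallel> + K \<delta>) / \<gamma>\<close>. Hence (\<open>multiplier_and_growth_bounds\<close>)
  \<open>h X - h Xs \<le> \<parallel>d\<parallel> \<delta> + C4 \<delta>\<^sup>3 + C5 \<parallel>d\<parallel> \<delta>\<^sup>2\<close>,
  with constants that do not depend on the penalty parameter.

  Regularity, \<open>\<delta> \<le> const * \<parallel>d\<parallel>\<close>, splits into two cases.
  \<^item> If \<open>X\<close> is feasible, quadratic growth together with \<open>\<parallel>X - Xs\<parallel> \<ge> \<sigma> \<delta>\<close> bounds \<open>h X - h Xs\<close> from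
    below by \<open>\<alpha> \<sigma>\<^sup>2 \<delta>\<^sup>2 / 2\<close>; cancel \<open>\<delta>\<close>. The lower bound on \<open>\<parallel>X - Xs\<parallel>\<close> holds because \<open>Rh\<^sup>T De\<close> is
    symmetric for the nearest factor (\<open>nearest_factor_symmetric\<close>, \<open>gram_expansion_lower_bound\<close>).
  \<^item> If \<open>X\<close> is infeasible, the penalty forces \<open>\<parallel>v\<parallel> \<ge> lam\<close> (\<open>infeasible_multiplier_ge\<close>), so
    \<open>\<parallel>w\<parallel> \<ge> 1\<close> once \<open>lam \<ge> \<parallel>y\<parallel> + 1\<close>. The bound on \<open>w\<close> then keeps \<open>\<parallel>d\<parallel>\<close> away from zero, and regularity
    is trivial for small \<open>\<delta>\<close>.

  Inserting regularity into the upper bound makes the cubic term a small multiple of \<open>\<parallel>d\<parallel> \<delta>\<close>, which is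
  norm convexity. The factors \<open>l = 4\<close> and \<open>l' = 8 / (\<sigma>\<^sup>2 \<alpha>)\<close> leave room for these crude steps.

  Two facts from linear algebra are needed: that the last entry of the list of singular values is
  the minimum of \<open>\<parallel>M v\<parallel> / \<parallel>v\<parallel>\<close>, which amounts to the spectral theorem for \<open>M\<^sup>T M\<close>, and that the
  factors of \<open>Xs\<close> form an orbit of the orthogonal group.
\<close>

section \<open>Frobenius inner product and positive semidefinite matrices\<close>

lemma inner_matrix_sum:
  fixes P Q :: "real^'n^'m"
  shows "P \<bullet> Q = (\<Sum>i\<in>UNIV. \<Sum>j\<in>UNIV. P $ i $ j * Q $ i $ j)"
  by (simp add: inner_vec_def)

lemma inner_transpose:
  fixes P Q :: "real^'n^'m"
  shows "transpose P \<bullet> transpose Q = P \<bullet> Q"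
  unfolding inner_matrix_sum transpose_def by (simp, rule sum.swap)

lemma norm_transpose:
  fixes P :: "real^'n^'m"
  shows "norm (transpose P) = norm P"
  by (simp add: norm_eq_sqrt_inner inner_transpose)

text \<open>
  Left and right multiplication by a matrix have multiplication by the transpose as adjoint, for
  the Frobenius inner product. All cross terms below are rearranged with this rule and the next.
\<close>

lemma inner_matrix_mult_left:
  fixes P :: "real^'l^'m" and Q :: "real^'n^'l" and C :: "real^'n^'m"
  shows "(P ** Q) \<bullet> C = Q \<bullet> (transpose P ** C)"
proof -
  have "(P ** Q) \<bullet> C = (\<Sum>i\<in>UNIV. \<Sum>j\<in>UNIV. \<Sum>k\<in>UNIV. P $ i $ k * Q $ k $ j * C $ i $ j)"
    by (simp add: inner_matrix_sum matrix_matrix_mult_def sum_distrib_right)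
  also have "\<dots> = (\<Sum>i\<in>UNIV. \<Sum>k\<in>UNIV. \<Sum>j\<in>UNIV. P $ i $ k * Q $ k $ j * C $ i $ j)"
    by (intro sum.cong refl sum.swap)
  also have "\<dots> = (\<Sum>k\<in>UNIV. \<Sum>i\<in>UNIV. \<Sum>j\<in>UNIV. P $ i $ k * Q $ k $ j * C $ i $ j)"
    by (rule sum.swap)
  also have "\<dots> = (\<Sum>k\<in>UNIV. \<Sum>j\<in>UNIV. \<Sum>i\<in>UNIV. P $ i $ k * Q $ k $ j * C $ i $ j)"
    by (intro sum.cong refl sum.swap)
  also have "\<dots> = Q \<bullet> (transpose P ** C)"
    by (simp add: inner_matrix_sum matrix_matrix_mult_def transpose_def sum_distrib_left mult_ac)
  finally show ?thesis .
qed

lemma inner_matrix_mult_right: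
  fixes P :: "real^'l^'m" and Q :: "real^'n^'l" and C :: "real^'n^'m"
  shows "(P ** Q) \<bullet> C = P \<bullet> (C ** transpose Q)"
proof -
  have "(P ** Q) \<bullet> C = (transpose Q ** transpose P) \<bullet> transpose C"
    by (metis inner_transpose matrix_transpose_mul)
  also have "\<dots> = transpose P \<bullet> transpose (C ** transpose Q)"
    by (simp add: inner_matrix_mult_left matrix_transpose_mul)
  finally show ?thesis by (simp add: inner_transpose)
qed

lemma norm_sq_columns:
  fixes P :: "real^'n^'m"
  shows "(norm P)\<^sup>2 = (\<Sum>j\<in>UNIV. (norm (column j P))\<^sup>2)"
proof -
  have "(norm P)\<^sup>2 = (\<Sum>i\<in>UNIV. \<Sum>j\<in>UNIV. P $ i $ j * P $ i $ j)"
    by (simp add: power2_norm_eq_inner inner_matrix_sum)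
  also have "\<dots> = (\<Sum>j\<in>UNIV. \<Sum>i\<in>UNIV. P $ i $ j * P $ i $ j)" by (rule sum.swap)
  finally show ?thesis
    by (simp add: power2_norm_eq_inner inner_vec_def column_def)
qed

lemma norm_matrix_vector_mult_le:
  fixes P :: "real^'n^'m"
  shows "norm (P *v x) \<le> norm P * norm x"
proof (rule power2_le_imp_le)
  have "(norm (P *v x))\<^sup>2 = (\<Sum>i\<in>UNIV. (P $ i \<bullet> x)\<^sup>2)"
    unfolding power2_norm_eq_inner inner_vec_def[of "P *v x" "P *v x"]
    by (simp add: matrix_vector_mul_component power2_eq_square)
  also have "\<dots> \<le> (\<Sum>i\<in>UNIV. (P $ i \<bullet> P $ i) * (x \<bullet> x))"
    by (intro sum_mono Cauchy_Schwarz_ineq)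
  also have "\<dots> = (norm P * norm x)\<^sup>2"
    unfolding power_mult_distrib power2_norm_eq_inner sum_distrib_right[symmetric] inner_vec_def[of P P] ..
  finally show "(norm (P *v x))\<^sup>2 \<le> (norm P * norm x)\<^sup>2" .
qed simp

lemma column_matrix_mult:
  fixes P :: "real^'l^'m" and Q :: "real^'n^'l"
  shows "column j (P ** Q) = P *v column j Q"
  by (simp add: column_def matrix_matrix_mult_def matrix_vector_mult_def vec_eq_iff)

lemma norm_matrix_mult_le:
  fixes P :: "real^'l^'m" and Q :: "real^'n^'l"
  shows "norm (P ** Q) \<le> norm P * norm Q"
proof (rule power2_le_imp_le)
  have "(norm (P ** Q))\<^sup>2 = (\<Sum>j\<in>UNIV. (norm (P *v column j Q))\<^sup>2)"
    by (simp add: norm_sq_columns column_matrix_mult)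
  also have "\<dots> \<le> (\<Sum>j\<in>UNIV. (norm P * norm (column j Q))\<^sup>2)"
    by (intro sum_mono power_mono norm_matrix_vector_mult_le) auto
  also have "\<dots> = (norm P * norm Q)\<^sup>2"
    by (simp add: power_mult_distrib norm_sq_columns[of Q] sum_distrib_left)
  finally show "(norm (P ** Q))\<^sup>2 \<le> (norm P * norm Q)\<^sup>2" .
qed simp

text \<open>
  A lower bound on \<open>P\<close> as an operator on vectors passes to matrices column by column; it will be
  applied with \<open>s\<close> the smallest singular value of \<open>P\<close>.
\<close>

lemma norm_matrix_mult_ge:
  fixes P :: "real^'l^'m" and Q :: "real^'n^'l"
  assumes "0 \<le> s" and "\<And>v. s * norm v \<le> norm (P *v v)"
  shows "s * norm Q \<le> norm (P ** Q)"
proof (rule power2_le_imp_le)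
  have "(s * norm Q)\<^sup>2 = (\<Sum>j\<in>UNIV. (s * norm (column j Q))\<^sup>2)"
    by (simp add: power_mult_distrib norm_sq_columns[of Q] sum_distrib_left)
  also have "\<dots> \<le> (\<Sum>j\<in>UNIV. (norm (P *v column j Q))\<^sup>2)"
    using assms by (intro sum_mono power_mono) auto
  also have "\<dots> = (norm (P ** Q))\<^sup>2"
    by (simp add: norm_sq_columns column_matrix_mult)
  finally show "(s * norm Q)\<^sup>2 \<le> (norm (P ** Q))\<^sup>2" .
qed simp

lemma inner_gram:
  fixes Z :: "real^'n^'n" and R :: "real^'r^'n"
  shows "Z \<bullet> gram R = (\<Sum>j\<in>UNIV. column j R \<bullet> (Z *v column j R))"
proof -
  have "Z \<bullet> gram R = (Z ** R) \<bullet> R"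
    unfolding gram_def by (metis inner_commute inner_matrix_mult_right)
  also have "\<dots> = transpose R \<bullet> transpose (Z ** R)" by (simp add: inner_transpose inner_commute)
  also have "\<dots> = (\<Sum>j\<in>UNIV. column j R \<bullet> (Z *v column j R))"
    unfolding inner_vec_def[of "transpose R"]
    by (rule sum.cong) (auto simp: column_matrix_mult[symmetric], simp add: column_def transpose_def)
  finally show ?thesis .
qed

text \<open>
  The first order condition for a minimum of a quadratic polynomial at \<open>0\<close>, in algebraic form.
\<close>

lemma quadratic_nonneg_imp_linear_coeff_eq_0:
  fixes a q :: real
  assumes "\<And>t. 0 \<le> 2 * t * a + t\<^sup>2 * q"
  shows "a = 0"
proof (rule ccontr)
  assume "a \<noteq> 0"
  then have p: "a\<^sup>2 > 0" by simp
  define m where "m = \<bar>q\<bar> + 1"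
  have m: "m > 0" "q \<le> m" by (auto simp: m_def)
  have "0 \<le> 2 * (- a / m) * a + (- a / m)\<^sup>2 * q" by (rule assms)
  also have "\<dots> \<le> 2 * (- a / m) * a + (- a / m)\<^sup>2 * m"
    using m by (intro add_left_mono mult_left_mono) auto
  also have "\<dots> = - (a\<^sup>2) / m" using m by (simp add: power2_eq_square field_simps)
  finally have "a\<^sup>2 / m \<le> 0" by simp
  then show False using divide_pos_pos[OF p m(1)] by simp
qed

text \<open>
  The vector \<open>v\<close> minimizes the quadratic form of \<open>Z\<close>, so its derivative there, \<open>2 Z v\<close>, vanishes; the
  proof varies \<open>v\<close> in the direction \<open>Z v\<close>.
\<close>

lemma psd_kernel:
  assumes "psd Z" and "v \<bullet> (Z *v v) = 0"
  shows "Z *v v = 0"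
proof -
  define w where "w = Z *v v"
  have symZ: "transpose Z = Z" using assms(1) by (simp add: psd_def sym_mats_def)
  have cross: "v \<bullet> (Z *v w) = w \<bullet> w"
    by (metis dot_lmul_matrix inner_commute symZ transpose_matrix_vector w_def)
  have ineq: "0 \<le> 2 * t * (w \<bullet> w) + t\<^sup>2 * (w \<bullet> (Z *v w))" for t
  proof -
    have "0 \<le> (v + t *\<^sub>R w) \<bullet> (Z *v (v + t *\<^sub>R w))" using assms(1) by (simp add: psd_def)
    also have "\<dots> = 2 * t * (w \<bullet> w) + t\<^sup>2 * (w \<bullet> (Z *v w))"
      using cross assms(2)
      by (simp add: matrix_vector_right_distrib inner_add_left inner_add_right power2_eq_square
          matrix_vector_mult_scaleR algebra_simps w_def[symmetric])
    finally show ?thesis .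
  qed
  have "w \<bullet> w = 0" by (rule quadratic_nonneg_imp_linear_coeff_eq_0) (rule ineq)
  then show ?thesis by (simp add: w_def)
qed

lemma psd_gram: "psd (gram R)"
proof -
  have "v \<bullet> (gram R *v v) = (transpose R *v v) \<bullet> (transpose R *v v)" for v
    unfolding gram_def matrix_vector_mul_assoc[symmetric]
    by (metis dot_lmul_matrix transpose_matrix_vector transpose_transpose)
  then show ?thesis
    by (simp add: psd_def sym_mats_def gram_def matrix_transpose_mul)
qed

lemma psd_inner_gram_nonneg: "psd Z \<Longrightarrow> 0 \<le> Z \<bullet> gram R"
  by (auto simp: inner_gram psd_def intro: sum_nonneg)

text \<open>
  Complementary slackness at the level of factors: \<open>\<langle>Z, R R\<^sup>T\<rangle>\<close> is the sum of the nonnegative values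
  of the quadratic form of \<open>Z\<close> at the columns of \<open>R\<close>, so every column lies in the kernel of \<open>Z\<close>.
\<close>

lemma psd_mult_eq_0:
  assumes "psd Z" and "Z \<bullet> gram R = 0"
  shows "Z ** R = 0"
proof -
  have "column j R \<bullet> (Z *v column j R) = 0" for j
    using assms sum_nonneg_eq_0_iff[of UNIV "\<lambda>j. column j R \<bullet> (Z *v column j R)"]
    by (auto simp: inner_gram psd_def)
  then have "column j (Z ** R) = 0" for j
    by (simp add: column_matrix_mult psd_kernel[OF assms(1)])
  then show ?thesis by (simp add: column_def vec_eq_iff)
qed

lemma matrix_add_rdistrib: "(P + P') ** Q = P ** Q + P' ** (Q :: real^'n^'l)"
  by (simp add: matrix_matrix_mult_def vec_eq_iff distrib_right sum.distrib)

lemma matrix_diff_ldistrib: "P ** (Q - Q') = P ** Q - P ** (Q' :: real^'n^'l)"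
  by (simp add: matrix_matrix_mult_def vec_eq_iff right_diff_distrib sum_subtractf)

lemma transpose_add: "transpose (P + Q) = transpose P + transpose (Q :: real^'n^'m)"
  by (simp add: transpose_def vec_eq_iff)

lemma transpose_diff: "transpose (P - Q) = transpose P - transpose (Q :: real^'n^'m)"
  by (simp add: transpose_def vec_eq_iff)

lemma matrix_diff_rdistrib: "(P - P') ** Q = P ** Q - P' ** (Q :: real^'n^'l)"
  by (simp add: matrix_matrix_mult_def vec_eq_iff left_diff_distrib sum_subtractf)

section \<open>The smallest singular value\<close>

lemma norm_matrix_vector_mult_sq:
  fixes M :: "real^'c^'m"
  shows "(norm (M *v v))\<^sup>2 = v \<bullet> ((transpose M ** M) *v v)"
  unfolding power2_norm_eq_inner matrix_vector_mul_assoc[symmetric]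
  by (metis dot_lmul_matrix inner_commute transpose_matrix_vector)

lemma gram_matrix_self_adjoint:
  fixes M :: "real^'c^'m"
  shows "((transpose M ** M) *v x) \<bullet> y = x \<bullet> ((transpose M ** M) *v y)"
  by (metis dot_lmul_matrix matrix_transpose_mul transpose_matrix_vector transpose_transpose)

lemma gram_matrix_inner:
  fixes M :: "real^'c^'m"
  shows "((transpose M ** M) *v x) \<bullet> y = (M *v x) \<bullet> (M *v y)"
  unfolding gram_matrix_self_adjoint unfolding matrix_vector_mul_assoc[symmetric]
  by (metis dot_lmul_matrix transpose_matrix_vector transpose_transpose)

text \<open>
  A minimizer of \<open>\<parallel>M x\<parallel>\<close> over the unit sphere of an invariant subspace of \<open>M\<^sup>T M\<close> is an eigenvector: the
  residual \<open>z = M\<^sup>T M x - s\<^sup>2 x\<close> lies in the subspace again, and minimality in the direction \<open>z\<close> forces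
  \<open>z = 0\<close>. With the whole space as \<open>V\<close> this yields the smallest singular value; with the
  orthogonal complement of the known eigenvectors it yields the spectral theorem.
\<close>

lemma rayleigh_minimizer:
  fixes M :: "real^'c^'m"
  assumes V: "subspace V" and inv: "\<And>x. x \<in> V \<Longrightarrow> (transpose M ** M) *v x \<in> V"
    and x0: "x0 \<in> V" "x0 \<noteq> 0"
  obtains s x where "0 \<le> s" "norm x = 1" "x \<in> V" "x \<in> sv_space M s"
    "\<And>y. y \<in> V \<Longrightarrow> s * norm y \<le> norm (M *v y)"
proof -
  define T where "T = transpose M ** M"
  have cpt: "compact (V \<inter> sphere 0 1)"
    using V by (simp add: closed_Int_compact closed_subspace)
  have "(1 / norm x0) *\<^sub>R x0 \<in> V \<inter> sphere 0 1"
    using x0 V by (simp add: subspace_scale)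
  then have ne: "V \<inter> sphere 0 1 \<noteq> {}" by blast
  have cont: "continuous_on (V \<inter> sphere 0 1) (\<lambda>x. norm (M *v x))"
    by (intro continuous_on_norm linear_continuous_on matrix_vector_mul_bounded_linear)
  obtain x where "x \<in> V \<inter> sphere 0 1"
    and "\<forall>y\<in>V \<inter> sphere 0 1. norm (M *v x) \<le> norm (M *v y)"
    using continuous_attains_inf[OF cpt ne cont] by (rule bexE)
  then have x: "x \<in> V" "norm x = 1"
    and min: "\<And>y. y \<in> V \<Longrightarrow> norm y = 1 \<Longrightarrow> norm (M *v x) \<le> norm (M *v y)"
    by auto
  define s where "s = norm (M *v x)"
  have bound: "s * norm y \<le> norm (M *v y)" if "y \<in> V" for y
  proof (cases "y = 0")
    case False
    have "s \<le> norm (M *v ((1 / norm y) *\<^sub>R y))"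
      unfolding s_def using False that V by (intro min) (auto simp: subspace_scale)
    also have "\<dots> = norm (M *v y) / norm y" by (simp add: matrix_vector_mult_scaleR)
    finally show ?thesis using False by (simp add: field_simps)
  qed simp
  define z where "z = T *v x - s\<^sup>2 *\<^sub>R x"
  have zV: "z \<in> V" unfolding z_def T_def using V x inv by (simp add: subspace_diff subspace_scale)
  have "z \<bullet> z = 0"
  proof (rule quadratic_nonneg_imp_linear_coeff_eq_0)
    fix t
    have "x + t *\<^sub>R z \<in> V" using V x zV by (simp add: subspace_add subspace_scale)
    then have "(s * norm (x + t *\<^sub>R z))\<^sup>2 \<le> (norm (M *v (x + t *\<^sub>R z)))\<^sup>2"
      by (intro power_mono bound) (auto simp: s_def)
    moreover have "(norm (x + t *\<^sub>R z))\<^sup>2 = 1 + 2 * t * (x \<bullet> z) + t\<^sup>2 * (z \<bullet> z)"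
      unfolding power2_norm_eq_inner using x(2)
      by (simp add: inner_add_left inner_add_right inner_commute power2_eq_square algebra_simps norm_eq_1)
    moreover have "(norm (M *v (x + t *\<^sub>R z)))\<^sup>2
        = s\<^sup>2 + 2 * t * ((T *v x) \<bullet> z) + t\<^sup>2 * (norm (M *v z))\<^sup>2"
      unfolding power2_norm_eq_inner s_def T_def gram_matrix_inner
      by (simp add: matrix_vector_right_distrib matrix_vector_mult_scaleR inner_add_left
          inner_add_right inner_commute power2_eq_square algebra_simps)
    moreover have "(T *v x) \<bullet> z = z \<bullet> z + s\<^sup>2 * (x \<bullet> z)"
      by (simp add: z_def inner_diff_left)
    ultimately show "0 \<le> 2 * t * (z \<bullet> z) + t\<^sup>2 * ((norm (M *v z))\<^sup>2 - s\<^sup>2 * (z \<bullet> z))"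
      by (simp add: power_mult_distrib algebra_simps)
  qed
  then have "x \<in> sv_space M s" by (simp add: z_def sv_space_def T_def)
  with that[of s x] x bound show ?thesis by (auto simp: s_def)
qed

lemma sv_space_orthogonal:
  fixes M :: "real^'c^'m"
  assumes "x \<in> sv_space M s" "y \<in> sv_space M t" "0 \<le> s" "0 \<le> t" "s \<noteq> t"
  shows "x \<bullet> y = 0"
proof -
  have "s\<^sup>2 * (x \<bullet> y) = t\<^sup>2 * (x \<bullet> y)"
    using gram_matrix_self_adjoint[of M x y] assms(1,2) by (simp add: sv_space_def)
  moreover have "s\<^sup>2 \<noteq> t\<^sup>2" using assms by (simp add: power2_eq_iff)
  ultimately show ?thesis by simp
qed

lemma dim_Union_sv_space:
  assumes "finite F" "F \<subseteq> sv_set M"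
  shows "dim (\<Union>s\<in>F. sv_space M s) = (\<Sum>s\<in>F. dim (sv_space M s))"
  using assms
proof (induction F rule: finite_induct)
  case (insert s F)
  have "dim (sv_space M s \<union> (\<Union>t\<in>F. sv_space M t))
      = dim (sv_space M s) + dim (\<Union>t\<in>F. sv_space M t)"
    using insert by (intro dim_orthogonal_sum) (auto intro!: sv_space_orthogonal simp: sv_set_def)
  with insert show ?case by simp
qed simp

lemma dim_sv_space_pos: "s \<in> sv_set M \<Longrightarrow> 0 < dim (sv_space M s)"
  by (auto simp: sv_set_def dim_eq_0 intro!: gr0I)

text \<open>
  Eigenspaces for different singular values are orthogonal, so there are at most as many of them as
  dimensions. Without finiteness, \<open>sorted_list_of_set\<close> would return the empty list.
\<close>

lemma finite_sv_set:
  fixes M :: "real^'c^'m"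
  shows "finite (sv_set M)"
proof -
  have "card F \<le> CARD('c)" if "finite F" "F \<subseteq> sv_set M" for F
  proof -
    have "card F = (\<Sum>s\<in>F. 1)" by simp
    also have "\<dots> \<le> (\<Sum>s\<in>F. dim (sv_space M s))"
      using that dim_sv_space_pos by (intro sum_mono) (force simp: Suc_le_eq)
    also have "\<dots> = dim (\<Union>s\<in>F. sv_space M s)" by (simp add: dim_Union_sv_space that)
    also have "\<dots> \<le> CARD('c)" using dim_subset_UNIV[of "\<Union>s\<in>F. sv_space M s"] by simp
    finally show ?thesis .
  qed
  then show ?thesis
    by (intro conjunct1[OF finite_if_finite_subsets_card_bdd[of _ "CARD('c)"]]) auto
qed

text \<open>
  By this count, \<open>singular_value CARD('c) M\<close> is the last entry of the list of singular values. If the sum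
  were smaller, some vector would be orthogonal to all eigenspaces, and the Rayleigh minimizer on
  their common orthogonal complement would be an eigenvector that is orthogonal to itself.
\<close>

lemma sum_dim_sv_space:
  fixes M :: "real^'c^'m"
  shows "(\<Sum>s\<in>sv_set M. dim (sv_space M s)) = CARD('c)"
proof (rule ccontr)
  define E where "E = (\<Union>s\<in>sv_set M. sv_space M s)"
  assume "(\<Sum>s\<in>sv_set M. dim (sv_space M s)) \<noteq> CARD('c)"
  then have "dim E \<noteq> DIM(real^'c)"
    by (simp add: E_def dim_Union_sv_space finite_sv_set)
  then have "dim E < DIM(real^'c)"
    using dim_subset_UNIV[of E] by linarith
  then obtain x0 where x0: "x0 \<noteq> 0" "\<And>y. y \<in> span E \<Longrightarrow> orthogonal x0 y"
    using orthogonal_to_subspace_exists by blast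
  define V where "V = {x. \<forall>y\<in>E. x \<bullet> y = 0}"
  have "subspace V" by (auto simp: V_def subspace_def inner_add_left)
  moreover have "(transpose M ** M) *v x \<in> V" if "x \<in> V" for x
    using that by (auto simp: V_def E_def gram_matrix_self_adjoint sv_space_def)
  moreover have "x0 \<in> V" using x0(2) by (auto simp: V_def orthogonal_def span_base)
  ultimately obtain s x where "0 \<le> s" "norm x = 1" "x \<in> V" "x \<in> sv_space M s"
    by (rule rayleigh_minimizer[of V M x0]) (use x0(1) in auto)
  moreover from this have "x \<noteq> 0" by auto
  then have "s \<in> sv_set M" using \<open>0 \<le> s\<close> \<open>x \<in> sv_space M s\<close> by (auto simp: sv_set_def)
  then have "x \<in> E" using \<open>x \<in> sv_space M s\<close> by (auto simp: E_def)
  ultimately show False by (auto simp: V_def norm_eq_1)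
qed

text \<open>
  The global Rayleigh minimizer \<open>x\<close> has a value \<open>s\<close> that is a singular value and is below all others,
  hence is the head of the increasing list and the last entry of its reversal.
\<close>

lemma smallest_singular_value:
  fixes M :: "real^'c^'m"
  obtains x where "norm x = 1" "norm (M *v x) = singular_value CARD('c) M"
    "\<And>y. singular_value CARD('c) M * norm y \<le> norm (M *v y)"
proof -
  obtain s x where s: "0 \<le> s" "norm x = 1" "x \<in> sv_space M s"
    and bound: "\<And>y. s * norm y \<le> norm (M *v y)"
    using rayleigh_minimizer[of UNIV M "axis undefined 1"] by (auto simp: axis_eq_0_iff)
  have nrm: "norm (M *v y) = t * norm y" if "0 \<le> t" "y \<in> sv_space M t" for t y
  proof -
    have "(norm (M *v y))\<^sup>2 = y \<bullet> (t\<^sup>2 *\<^sub>R y)"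
      using that by (simp add: norm_matrix_vector_mult_sq sv_space_def)
    then have "(norm (M *v y))\<^sup>2 = (t * norm y)\<^sup>2"
      by (simp add: power_mult_distrib power2_norm_eq_inner)
    then show ?thesis using that by (simp add: power2_eq_iff_nonneg)
  qed
  have "x \<noteq> 0" using s(2) by auto
  then have s_in: "s \<in> sv_set M" using s by (auto simp: sv_set_def)
  have s_min: "s \<le> t" if t: "t \<in> sv_set M" for t
  proof -
    obtain v where v: "v \<noteq> 0" "v \<in> sv_space M t" "0 \<le> t" using t by (auto simp: sv_set_def)
    then show ?thesis using bound[of v] nrm[of t v] by simp
  qed
  define ss where "ss = sorted_list_of_set (sv_set M)"
  define l where "l = concat (map (\<lambda>s. replicate (dim (sv_space M s)) s) ss)"
  have "length l = (\<Sum>s\<leftarrow>ss. dim (sv_space M s))"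
    by (simp add: l_def length_concat comp_def)
  also have "\<dots> = CARD('c)"
    using sum_dim_sv_space[of M]
    by (simp add: ss_def sum_list_distinct_conv_sum_set finite_sv_set)
  finally have len: "length l = CARD('c)" .
  have hd: "l ! 0 = s"
  proof (cases ss)
    case Nil
    then show ?thesis using s_in finite_sv_set[of M] by (simp add: ss_def)
  next
    case (Cons a as)
    have set: "set ss = sv_set M" by (simp add: ss_def finite_sv_set)
    have "sorted ss" by (simp add: ss_def)
    then have "a \<le> s" using s_in set Cons by auto
    moreover have a: "a \<in> sv_set M" using set Cons by auto
    ultimately have "a = s" using s_min by force
    then show ?thesis using Cons dim_sv_space_pos[OF a] by (simp add: l_def nth_append)
  qed
  have "singular_value CARD('c) M = s"
    unfolding singular_value_def singular_values_def ss_def[symmetric] l_def[symmetric]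
    using len hd by (simp add: rev_nth)
  with that[of x] s bound nrm[of s x] show ?thesis by simp
qed

lemma singular_value_bound:
  fixes M :: "real^'c^'m"
  shows "singular_value CARD('c) M * norm v \<le> norm (M *v v)"
  using smallest_singular_value[of M] by metis

lemma singular_value_pos:
  fixes M :: "real^'c^'m"
  assumes "rank M = CARD('c)"
  shows "0 < singular_value CARD('c) M"
proof -
  obtain x where x: "norm x = 1" "norm (M *v x) = singular_value CARD('c) M"
    using smallest_singular_value[of M] by metis
  have "inj ((*v) M)" using assms full_rank_injective by blast
  then have "M *v x \<noteq> 0" using x(1) by (metis inj_def matrix_vector_mult_0_right norm_zero zero_neq_one)
  then show ?thesis using x(2) by (metis zero_less_norm_iff)
qed

section \<open>The factors of a positive semidefinite matrix\<close>

lemma norm_sq_eq_trace_gram: "(norm R)\<^sup>2 = mat 1 \<bullet> gram R"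
  unfolding gram_def by (metis inner_commute inner_matrix_mult_right matrix_mul_lid power2_norm_eq_inner)

lemma norm_factor_eq: "gram R = gram R' \<Longrightarrow> norm R = norm R'"
  by (metis norm_ge_zero norm_sq_eq_trace_gram power2_eq_imp_eq)

lemma gram_mult_orthogonal:
  fixes R :: "real^'r^'n"
  assumes "orthogonal_matrix Q"
  shows "gram (R ** Q) = gram R"
proof -
  have "Q ** transpose Q = mat 1" using assms by (simp add: orthogonal_matrix_def)
  then show ?thesis
    unfolding gram_def matrix_transpose_mul by (metis matrix_mul_assoc matrix_mul_rid)
qed

lemma norm_mult_orthogonal:
  fixes R :: "real^'r^'n"
  assumes "orthogonal_matrix Q"
  shows "norm (R ** Q) = norm R"
  using norm_factor_eq[OF gram_mult_orthogonal[OF assms]] .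

text \<open>
  With \<open>N = R\<^sup>T R\<close> invertible and \<open>B\<close> its inverse, the only candidate is the least squares solution
  \<open>Q = B R\<^sup>T R'\<close> of \<open>R Q = R'\<close>; equality of the Gram matrices gives \<open>R' Q\<^sup>T = R\<close>, from which both claims follow.
\<close>

lemma factors_differ_by_orthogonal:
  fixes R R' :: "real^'r^'n"
  assumes "rank R = CARD('r)" "gram R' = gram R"
  obtains Q where "orthogonal_matrix Q" "R' = R ** Q"
proof -
  define N where "N = transpose R ** R"
  have injR: "inj ((*v) R)" using assms(1) full_rank_injective by blast
  have "v = 0" if "N *v v = 0" for v
  proof -
    have "(norm (R *v v))\<^sup>2 = 0" using that by (simp only: norm_matrix_vector_mult_sq N_def inner_zero_right)
    then show ?thesis using injR by (metis injD matrix_vector_mult_0_right norm_eq_zero power_eq_0_iff)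
  qed
  then obtain B where BN: "B ** N = mat 1"
    using matrix_left_invertible_ker by blast
  have NB: "N ** transpose B = mat 1"
    by (metis BN N_def matrix_transpose_mul transpose_mat transpose_transpose)
  define Q where "Q = B ** transpose R ** R'"
  have RQ: "R' ** transpose Q = R"
  proof -
    have "R' ** transpose Q = gram R' ** R ** transpose B"
      by (simp add: Q_def gram_def matrix_transpose_mul matrix_mul_assoc)
    also have "\<dots> = R ** (N ** transpose B)"
      by (simp only: assms(2)) (simp add: gram_def N_def matrix_mul_assoc)
    finally show ?thesis by (simp add: NB)
  qed
  have QQ: "Q ** transpose Q = mat 1"
  proof -
    have "Q ** transpose Q = B ** transpose R ** (R' ** transpose Q)"
      by (simp add: Q_def matrix_mul_assoc)
    then show ?thesis using BN by (simp add: RQ N_def matrix_mul_assoc)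
  qed
  then have QQ': "transpose Q ** Q = mat 1" using matrix_left_right_inverse by blast
  then have "R' = R ** Q" using RQ by (metis matrix_mul_assoc matrix_mul_rid)
  with that[of Q] QQ' show ?thesis by (simp add: orthogonal_matrix)
qed

text \<open>
  The smallest singular value is invariant under \<open>Rh = Rs Q\<close>, so one constant serves the whole factor set.
\<close>

lemma factor_set_singular_value_bound:
  fixes Rs Rh :: "real^'r^'n"
  assumes "rank Rs = CARD('r)" "gram Rh = gram Rs"
  shows "singular_value CARD('r) Rs * norm v \<le> norm (Rh *v v)"
proof -
  obtain Q where Q: "orthogonal_matrix Q" "Rh = Rs ** Q"
    using factors_differ_by_orthogonal[OF assms] .
  have "norm (Q *v v) = norm v"
    using Q(1) orthogonal_transformation_matrix[of "(*v) Q"]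
    by (simp add: orthogonal_transformation_norm matrix_of_matrix_vector_mul)
  then show ?thesis
    using singular_value_bound[of Rs "Q *v v"] by (simp add: Q(2) matrix_vector_mul_assoc)
qed

lemma compact_factor_set: "compact (factor_set X :: (real^'r^'n) set)"
proof -
  have "bounded (factor_set X :: (real^'r^'n) set)"
  proof (cases "factor_set X = ({} :: (real^'r^'n) set)")
    case False
    then obtain R0 :: "real^'r^'n" where "gram R0 = X" by (auto simp: factor_set_def)
    then have "norm R \<le> norm R0" if "R \<in> factor_set X" for R :: "real^'r^'n"
      using that norm_factor_eq[of R R0] by (simp add: factor_set_def)
    then show ?thesis by (auto simp: bounded_iff)
  qed simp
  moreover have "closed (factor_set X :: (real^'r^'n) set)"
    unfolding factor_set_def gram_def matrix_matrix_mult_def transpose_def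
    by (intro closed_Collect_eq continuous_intros)
  ultimately show ?thesis by (simp add: compact_eq_bounded_closed)
qed

lemma axis_axis_mult_vec:
  fixes x :: "real^'n"
  shows "(axis i (axis j 1) :: real^'n^'m) *v x = axis i (x $ j)"
proof (subst vec_eq_iff, rule allI)
  fix k
  show "((axis i (axis j 1) :: real^'n^'m) *v x) $ k = axis i (x $ j) $ k"
    unfolding matrix_vector_mul_component
    by (cases "k = i") (simp_all add: axis_nth inner_axis' axis_eq_0_iff, simp_all add: axis_def)
qed

text \<open>
  The first order optimality condition of the orthogonal Procrustes problem. Instead of
  differentiating along a curve of rotations, compare the identity with one rotation \<open>Q\<close> in the plane of the
  coordinates \<open>i\<close> and \<open>j\<close>. For a rotation with cosine \<open>c\<close> and sine \<open>s\<close> the change of the objective is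
  \<open>(c - 1) a + s d\<close>, where \<open>a = P\<^sub>i\<^sub>i + P\<^sub>j\<^sub>j\<close> and \<open>d = P\<^sub>i\<^sub>j - P\<^sub>j\<^sub>i\<close>. Its maximum \<open>sqrt (a\<^sup>2 + d\<^sup>2) - a\<close> is positive
  unless \<open>d = 0\<close>.
\<close>

lemma trace_maximal_imp_symmetric:
  fixes P :: "real^'n^'n"
  assumes max: "\<And>Q. orthogonal_matrix Q \<Longrightarrow> P \<bullet> Q \<le> P \<bullet> mat 1"
  shows "transpose P = P"
proof -
  have "P $ i $ j = P $ j $ i" if "i \<noteq> j" for i j
  proof (rule ccontr)
    define a where "a = P $ i $ i + P $ j $ j"
    define d where "d = P $ i $ j - P $ j $ i"
    define \<rho> where "\<rho> = sqrt (a\<^sup>2 + d\<^sup>2)"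
    assume "P $ i $ j \<noteq> P $ j $ i"
    then have d: "d \<noteq> 0" by (simp add: d_def)
    then have pos: "0 < a\<^sup>2 + d\<^sup>2" by (simp add: add_nonneg_pos)
    then have \<rho>: "\<rho> > 0" "\<rho>\<^sup>2 = a\<^sup>2 + d\<^sup>2" by (auto simp: \<rho>_def)
    define c s where "c = a / \<rho>" and "s = d / \<rho>"
    have cs: "c\<^sup>2 + s\<^sup>2 = 1"
      using \<rho> pos d by (simp add: c_def s_def power_divide add_divide_distrib[symmetric])
    define Q :: "real^'n^'n" where "Q = mat 1 + (c - 1) *\<^sub>R (axis i (axis i 1) + axis j (axis j 1))
        + s *\<^sub>R (axis i (axis j 1) - axis j (axis i 1))"
    have Qv: "Q *v x = x + ((c - 1) * x $ i + s * x $ j) *\<^sub>R axis i 1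
        + ((c - 1) * x $ j - s * x $ i) *\<^sub>R axis j 1" for x
      by (simp add: Q_def matrix_vector_mult_add_rdistrib matrix_vector_mult_diff_rdistrib
          scaleR_matrix_vector_assoc[symmetric] axis_axis_mult_vec)
        (simp add: vec_eq_iff axis_def algebra_simps)
    have "norm (Q *v x) = norm x" for x
    proof -
      define p q where "p = (c - 1) * x $ i + s * x $ j" and "q = (c - 1) * x $ j - s * x $ i"
      have "(Q *v x) \<bullet> (Q *v x) = x \<bullet> x + 2 * p * x $ i + 2 * q * x $ j + p\<^sup>2 + q\<^sup>2"
        unfolding Qv p_def[symmetric] q_def[symmetric]
        using that by (simp add: inner_add_left inner_add_right inner_axis_axis inner_axis[of x] inner_axis'[of _ _ x]
            power2_eq_square algebra_simps)
      also have "\<dots> = x \<bullet> x - (x $ i)\<^sup>2 - (x $ j)\<^sup>2 + (c\<^sup>2 + s\<^sup>2) * ((x $ i)\<^sup>2 + (x $ j)\<^sup>2)"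
        unfolding p_def q_def by (simp add: power2_eq_square algebra_simps)
      finally show ?thesis by (simp add: cs norm_eq_sqrt_inner)
    qed
    then have "orthogonal_transformation ((*v) Q)"
      by (simp add: orthogonal_transformation)
    then have "orthogonal_matrix Q"
      using orthogonal_transformation_matrix[of "(*v) Q"] by (simp add: matrix_of_matrix_vector_mul)
    from max[OF this] have "(c - 1) * a + s * d \<le> 0"
      by (simp add: Q_def inner_add_right inner_diff_right inner_axis a_def d_def)
    moreover have "c * a + s * d = \<rho>\<^sup>2 / \<rho>"
      unfolding \<rho>(2) by (simp add: c_def s_def power2_eq_square add_divide_distrib)
    then have "c * a + s * d = \<rho>" by (simp add: power2_eq_square)
    ultimately have "\<rho> \<le> a" by (simp add: algebra_simps)
    then have "\<rho>\<^sup>2 \<le> a\<^sup>2" using \<rho>(1) by (intro power_mono) auto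
    then show False using \<rho>(2) d by simp
  qed
  then have "P $ i $ j = P $ j $ i" for i j by (cases "i = j") auto
  then show ?thesis by (simp add: transpose_def vec_eq_iff)
qed

text \<open>
  All factors \<open>Rh Q\<close> have the same norm, so the nearest one maximizes \<open>\<langle>R, Rh Q\<rangle> = \<langle>Rh\<^sup>T R, Q\<rangle>\<close>
  over orthogonal \<open>Q\<close>, with maximum at the identity. Subtracting the symmetric matrix \<open>Rh\<^sup>T Rh\<close> turns \<open>R\<close> into
  the difference.
\<close>

lemma nearest_factor_symmetric:
  fixes R Rh :: "real^'r^'n"
  assumes near: "\<And>R'. gram R' = gram Rh \<Longrightarrow> norm (R - Rh) \<le> norm (R - R')"
  shows "transpose (transpose Rh ** (R - Rh)) = transpose Rh ** (R - Rh)"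
proof -
  have "transpose (transpose Rh ** R) = transpose Rh ** R"
  proof (rule trace_maximal_imp_symmetric)
    fix Q :: "real^'r^'r" assume Q: "orthogonal_matrix Q"
    have "(norm (R - Rh))\<^sup>2 \<le> (norm (R - Rh ** Q))\<^sup>2"
      using near[OF gram_mult_orthogonal[OF Q]] by (intro power_mono) auto
    moreover have "(norm (Rh ** Q))\<^sup>2 = (norm Rh)\<^sup>2" by (simp add: norm_mult_orthogonal Q)
    ultimately have "(Rh ** Q) \<bullet> R \<le> (Rh ** mat 1) \<bullet> R"
      by (simp add: power2_norm_eq_inner inner_diff_left inner_diff_right inner_commute)
    moreover have "(transpose Rh ** R) \<bullet> Q' = (Rh ** Q') \<bullet> R" for Q'
      using inner_matrix_mult_left[of "transpose Rh" R Q'] by (simp add: inner_commute)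
    ultimately show "(transpose Rh ** R) \<bullet> Q \<le> (transpose Rh ** R) \<bullet> mat 1"
      by (simp only:)
  qed
  then show ?thesis
    by (simp add: matrix_diff_ldistrib transpose_diff) (simp add: matrix_transpose_mul)
qed

lemma gram_add:
  "gram (Rh + De) = gram Rh + (Rh ** transpose De + De ** transpose Rh) + gram De"
  by (simp add: gram_def transpose_add matrix_add_ldistrib matrix_add_rdistrib)

text \<open>
  With \<open>T = Rh De\<^sup>T\<close>, the linear part \<open>T + T\<^sup>T\<close> of the expansion satisfies
  \<open>\<parallel>T + T\<^sup>T\<parallel>\<^sup>2 = 2 \<parallel>T\<parallel>\<^sup>2 + 2 \<langle>T, T\<^sup>T\<rangle>\<close>. Symmetry of \<open>P = Rh\<^sup>T De\<close> makes the cross term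
  \<open>\<langle>T, T\<^sup>T\<rangle> = \<langle>P, P\<^sup>T\<rangle> = \<parallel>P\<parallel>\<^sup>2\<close> nonnegative.
\<close>

lemma gram_expansion_lower_bound:
  fixes Rh De :: "real^'r^'n"
  assumes sym: "transpose (transpose Rh ** De) = transpose Rh ** De"
    and s: "0 \<le> s" "\<And>v. s * norm v \<le> norm (Rh *v v)"
  shows "sqrt 2 * s * norm De - (norm De)\<^sup>2 \<le> norm (gram (Rh + De) - gram Rh)"
proof -
  define T where "T = Rh ** transpose De"
  have tT: "transpose T = De ** transpose Rh" by (simp add: T_def matrix_transpose_mul)
  have "T \<bullet> transpose T = transpose De \<bullet> (transpose Rh ** De ** transpose Rh)"
    by (simp add: T_def inner_matrix_mult_left matrix_transpose_mul matrix_mul_assoc)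
  also have "\<dots> = (transpose Rh ** De) \<bullet> (transpose De ** Rh)"
    by (simp add: inner_commute[of "transpose De"] inner_matrix_mult_right)
  also have "\<dots> = (transpose Rh ** De) \<bullet> transpose (transpose Rh ** De)"
    by (simp add: matrix_transpose_mul)
  finally have cross: "0 \<le> T \<bullet> transpose T" by (simp add: sym)
  have "(sqrt 2 * s * norm De)\<^sup>2 = 2 * (s * norm (transpose De))\<^sup>2"
    by (simp add: power_mult_distrib norm_transpose)
  also have "\<dots> \<le> 2 * (norm T)\<^sup>2"
    unfolding T_def using s by (intro mult_left_mono power_mono norm_matrix_mult_ge) auto
  also have "\<dots> \<le> (norm (T + transpose T))\<^sup>2"
    using cross
    by (simp add: power2_norm_eq_inner inner_add_left inner_add_right inner_transpose inner_commute)
  finally have "sqrt 2 * s * norm De \<le> norm (T + transpose T)" by (rule power2_le_imp_le) simp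
  moreover have "norm (T + transpose T) \<le> norm (gram (Rh + De) - gram Rh) + norm (gram De)"
  proof -
    have "gram (Rh + De) - gram Rh = T + transpose T + gram De"
      unfolding tT by (simp add: gram_add T_def)
    then show ?thesis using norm_triangle_ineq4[of "T + transpose T + gram De" "gram De"] by simp
  qed
  moreover have "norm (gram De) \<le> (norm De)\<^sup>2"
    using norm_matrix_mult_le[of De "transpose De"]
    by (simp add: gram_def norm_transpose power2_eq_square)
  ultimately show ?thesis by linarith
qed

section \<open>The subdifferential of the penalized function\<close>

definition meas_adj :: "('k::finite \<Rightarrow> real^'n^'n) \<Rightarrow> real^'k \<Rightarrow> real^'n^'n" where
  "meas_adj A w = (\<Sum>i\<in>UNIV. (w $ i) *\<^sub>R A i)"

lemma linear_meas_adj: "linear (meas_adj A)"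
  by (rule linearI) (simp_all add: meas_adj_def sum.distrib scaleR_add_left scaleR_right.sum)

lemma linear_meas_map: "linear (meas_map A)"
  by (rule linearI) (simp_all add: meas_map_def vec_eq_iff inner_add_right)

lemma meas_adj_inner: "meas_adj A w \<bullet> X = w \<bullet> meas_map A X"
  by (simp add: meas_adj_def meas_map_def inner_sum_left inner_vec_def[of w])

lemma subspace_sym_mats: "subspace (sym_mats :: (real^'n^'n) set)"
  by (auto simp: subspace_def sym_mats_def transpose_add) (simp_all add: transpose_def vec_eq_iff)

lemma meas_adj_sym: "(\<And>i. A i \<in> sym_mats) \<Longrightarrow> meas_adj A w \<in> sym_mats"
  unfolding meas_adj_def by (intro subspace_sum subspace_scale subspace_sym_mats)

lemma gram_sym: "gram R \<in> sym_mats"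
  using psd_gram[of R] by (simp add: psd_def)

text \<open>
  The product of \<open>cq_matrix A R\<close> with \<open>w\<close> lists the entries of \<open>(\<Sum>\<^sub>i w\<^sub>i A\<^sub>i) R\<close>, so the constraint
  qualification says that \<open>w\<close> is controlled by this matrix.
\<close>

lemma cq_matrix_bound:
  fixes A :: "'k::finite \<Rightarrow> real^'n^'n" and R :: "real^'r^'n"
  shows "singular_value CARD('k) (cq_matrix A R) * norm w \<le> norm (meas_adj A w ** R)"
proof -
  have entry: "(cq_matrix A R *v w) $ p = (meas_adj A w ** R) $ fst p $ snd p" for p
  proof -
    have "(meas_adj A w ** R) $ i $ j = (\<Sum>l\<in>UNIV. (A l ** R) $ i $ j * w $ l)" for i j
    proof -
      have "(meas_adj A w ** R) $ i $ j = (\<Sum>k\<in>UNIV. \<Sum>l\<in>UNIV. w $ l * A l $ i $ k * R $ k $ j)"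
        by (simp add: meas_adj_def matrix_matrix_mult_def sum_distrib_right)
      also have "\<dots> = (\<Sum>l\<in>UNIV. \<Sum>k\<in>UNIV. w $ l * A l $ i $ k * R $ k $ j)" by (rule sum.swap)
      finally show ?thesis
        by (simp add: matrix_matrix_mult_def sum_distrib_right sum_distrib_left mult_ac)
    qed
    then show ?thesis by (simp add: cq_matrix_def matrix_vector_mult_def)
  qed
  have "(norm (cq_matrix A R *v w))\<^sup>2
      = (\<Sum>p\<in>UNIV. ((meas_adj A w ** R) $ fst p $ snd p)\<^sup>2)"
    unfolding power2_norm_eq_inner inner_vec_def[of "cq_matrix A R *v w"] entry
    by (simp add: power2_eq_square)
  also have "\<dots> = (\<Sum>i\<in>UNIV. \<Sum>j\<in>UNIV. ((meas_adj A w ** R) $ i $ j)\<^sup>2)"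
    unfolding UNIV_Times_UNIV[symmetric] sum.cartesian_product by (simp add: case_prod_beta)
  also have "\<dots> = (norm (meas_adj A w ** R))\<^sup>2"
    unfolding power2_norm_eq_inner inner_matrix_sum by (simp add: power2_eq_square)
  finally have "norm (cq_matrix A R *v w) = norm (meas_adj A w ** R)"
    by (simp add: power2_eq_iff_nonneg)
  then show ?thesis using singular_value_bound[of "cq_matrix A R" w] by simp
qed

text \<open>
  Passes to the limit in difference quotients. Applied to the subgradient inequality of \<open>f\<close> plus the penalty along a
  segment on which the penalty is affine, it needs no derivative of the penalty.
\<close>

lemma directional_derivative_ge:
  fixes f :: "real^'n^'n \<Rightarrow> real"
  assumes der: "(f has_derivative (\<lambda>D. G \<bullet> D)) (at X within sym_mats)"
    and X: "X \<in> sym_mats" and D: "D \<in> sym_mats"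
    and bound: "\<And>t. 0 < t \<Longrightarrow> t < 1 \<Longrightarrow> t * c \<le> f (X + t *\<^sub>R D) - f X"
  shows "c \<le> G \<bullet> D"
proof -
  have line: "((\<lambda>t. X + t *\<^sub>R D) has_derivative (\<lambda>t. t *\<^sub>R D)) (at 0 within {0<..})"
    by (auto intro!: derivative_eq_intros)
  have "(\<lambda>t. X + t *\<^sub>R D) ` {0<..} \<subseteq> sym_mats"
    using X D subspace_sym_mats by (auto intro!: subspace_add subspace_scale)
  then have "(f has_derivative (\<lambda>D. G \<bullet> D)) (at (X + 0 *\<^sub>R D) within (\<lambda>t. X + t *\<^sub>R D) ` {0<..})"
    using der has_derivative_subset by simp blast
  from has_derivative_in_compose[OF line this]
  have "((\<lambda>t. f (X + t *\<^sub>R D)) has_field_derivative (G \<bullet> D)) (at 0 within {0<..})"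
    by (simp add: has_field_derivative_def mult_commute_abs)
  then have "((\<lambda>t. (f (X + t *\<^sub>R D) - f X) / t) \<longlongrightarrow> G \<bullet> D) (at_right 0)"
    by (simp add: has_field_derivative_iff)
  moreover have "\<forall>\<^sub>F t in at_right 0. c \<le> (f (X + t *\<^sub>R D) - f X) / t"
    using eventually_at_right_real[OF zero_less_one]
  proof eventually_elim
    case (elim t)
    then show ?case using bound[of t] by (simp add: field_simps)
  qed
  ultimately show ?thesis
    by (rule tendsto_lowerbound) simp
qed

lemma convex_gradient_inequality:
  fixes f :: "real^'n^'n \<Rightarrow> real"
  assumes cvx: "convex_on sym_mats f"
    and der: "(f has_derivative (\<lambda>D. G \<bullet> D)) (at X within sym_mats)"
    and X: "X \<in> sym_mats" and Y: "Y \<in> sym_mats"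
  shows "f X + G \<bullet> (Y - X) \<le> f Y"
proof -
  have "- (f Y - f X) \<le> (- G) \<bullet> (Y - X)"
  proof (rule directional_derivative_ge)
    show "((\<lambda>X. - f X) has_derivative (\<lambda>D. (- G) \<bullet> D)) (at X within sym_mats)"
      using has_derivative_minus[OF der] by simp
    show "Y - X \<in> sym_mats" by (rule subspace_diff[OF subspace_sym_mats Y X])
    fix t :: real assume t: "0 < t" "t < 1"
    have "f ((1 - t) *\<^sub>R X + t *\<^sub>R Y) \<le> (1 - t) * f X + t * f Y"
      using cvx t X Y by (intro convex_onD) auto
    moreover have "X + t *\<^sub>R (Y - X) = (1 - t) *\<^sub>R X + t *\<^sub>R Y" by (simp add: algebra_simps)
    ultimately show "t * - (f Y - f X) \<le> - f (X + t *\<^sub>R (Y - X)) - - f X"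
      by (simp add: algebra_simps)
  qed (fact X)
  then show ?thesis by simp
qed

text \<open>
  Nonemptiness matters because \<open>infdist\<close> to the empty set is \<open>0\<close>. A subgradient is the gradient of \<open>f\<close>
  plus the multiplier \<open>lam u\<close> with \<open>u\<close> the normalized residual; \<open>sgn\<close> gives \<open>u = 0\<close> at feasible points.
\<close>

lemma sym_subdiff_penalized_nonempty:
  fixes A :: "'k::finite \<Rightarrow> real^'n^'n"
  assumes A: "\<And>i. A i \<in> sym_mats" and cvx: "convex_on sym_mats f"
    and der: "(f has_derivative (\<lambda>D. G \<bullet> D)) (at X within sym_mats)"
    and X: "X \<in> sym_mats" and G: "G \<in> sym_mats" and lam: "0 \<le> lam"
  shows "sym_subdiff (penalized f A b lam) X \<noteq> {}"
proof -
  define e where "e Y = meas_map A Y - b" for Y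
  define u where "u = sgn (e X)"
  have "G + meas_adj A (lam *\<^sub>R u) \<in> sym_subdiff (penalized f A b lam) X"
    unfolding sym_subdiff_def
  proof (intro CollectI conjI ballI)
    show "G + meas_adj A (lam *\<^sub>R u) \<in> sym_mats"
      using A G by (intro subspace_add subspace_sym_mats meas_adj_sym)
    fix Y :: "real^'n^'n" assume Y: "Y \<in> sym_mats"
    have "u \<bullet> e X = norm (e X)"
      by (cases "e X = 0") (simp_all add: u_def sgn_div_norm dot_square_norm power2_eq_square)
    moreover have "u \<bullet> e Y \<le> norm (e Y)"
    proof -
      have "u \<bullet> e Y \<le> norm u * norm (e Y)" by (rule norm_cauchy_schwarz)
      also have "\<dots> \<le> 1 * norm (e Y)"
        by (intro mult_right_mono) (auto simp: u_def norm_sgn)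
      finally show ?thesis by simp
    qed
    moreover have "meas_adj A (lam *\<^sub>R u) \<bullet> (Y - X) = lam * (u \<bullet> e Y - u \<bullet> e X)"
      by (simp add: meas_adj_inner linear_diff[OF linear_meas_map] e_def inner_diff_right algebra_simps)
    moreover have "f X + G \<bullet> (Y - X) \<le> f Y"
      by (rule convex_gradient_inequality[OF cvx der X Y])
    ultimately show "penalized f A b lam Y
        \<ge> penalized f A b lam X + (G + meas_adj A (lam *\<^sub>R u)) \<bullet> (Y - X)"
      using mult_left_mono[of "u \<bullet> e Y" "norm (e Y)" lam] lam
      by (simp add: penalized_def e_def[symmetric] inner_add_left algebra_simps)
  qed
  then show ?thesis by blast
qed

text \<open>
  Along a direction \<open>D\<close> in the kernel of \<open>meas_map A\<close> the penalty is constant, so a subgradient agrees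
  with the gradient of \<open>f\<close> on \<open>D\<close> and on \<open>-D\<close>. Hence the difference is orthogonal to the kernel, that is, in
  the range of the adjoint.
\<close>

lemma sym_subdiff_penalized_representation:
  fixes A :: "'k::finite \<Rightarrow> real^'n^'n"
  assumes A: "\<And>i. A i \<in> sym_mats"
    and der: "(f has_derivative (\<lambda>D. G0 \<bullet> D)) (at X within sym_mats)"
    and X: "X \<in> sym_mats" and G0: "G0 \<in> sym_mats"
    and G: "G \<in> sym_subdiff (penalized f A b lam) X"
  obtains v where "G = G0 + meas_adj A v"
proof -
  have Gs: "G \<in> sym_mats"
    and sub: "\<And>Y. Y \<in> sym_mats \<Longrightarrow>
      penalized f A b lam X + G \<bullet> (Y - X) \<le> penalized f A b lam Y"
    using G by (auto simp: sym_subdiff_def)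
  have ge: "G \<bullet> D \<le> G0 \<bullet> D" if D: "D \<in> sym_mats" "meas_map A D = 0" for D
  proof (rule directional_derivative_ge[OF der X D(1)])
    fix t :: real assume "0 < t" "t < 1"
    have "X + t *\<^sub>R D \<in> sym_mats"
      using X D(1) by (intro subspace_add subspace_scale subspace_sym_mats)
    from sub[OF this] show "t * (G \<bullet> D) \<le> f (X + t *\<^sub>R D) - f X"
      using D(2) linear_meas_map[of A]
      by (simp add: penalized_def linear_add linear_scale)
  qed
  have subsp: "subspace (range (meas_adj A))"
    by (simp add: linear_meas_adj linear_subspace_image)
  obtain y z where y: "y \<in> span (range (meas_adj A))"
    and z: "\<And>w. w \<in> span (range (meas_adj A)) \<Longrightarrow> orthogonal z w"
    and yz: "G - G0 = y + z"
    using orthogonal_subspace_decomp_exists[of "range (meas_adj A)" "G - G0"] by blast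
  obtain v where v: "y = meas_adj A v" using y subsp by (auto simp: span_eq_iff[THEN iffD2])
  have z_eq: "z = G - G0 - y" using yz by simp
  have zs: "z \<in> sym_mats"
    unfolding z_eq v by (intro subspace_diff subspace_sym_mats Gs G0 meas_adj_sym A)
  have "z \<bullet> meas_adj A w = 0" for w
    using z[of "meas_adj A w"] by (simp add: orthogonal_def span_base)
  then have "w \<bullet> meas_map A z = 0" for w
    by (metis inner_commute meas_adj_inner)
  then have mz: "meas_map A z = 0" by (metis inner_eq_zero_iff)
  have "- z \<in> sym_mats" "meas_map A (- z) = 0"
    using subspace_neg[OF subspace_sym_mats zs] mz by (simp_all add: linear_neg[OF linear_meas_map])
  then have "(G - G0) \<bullet> z = 0"
    using ge[of z] ge[of "- z"] zs mz by (simp add: inner_diff_left)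
  moreover have "y \<bullet> z = 0" by (simp add: v meas_adj_inner mz)
  ultimately have "z = 0" using yz by (simp add: inner_add_left)
  with that[of v] yz v show ?thesis by (simp add: algebra_simps)
qed

text \<open>
  On the segment from \<open>X\<close> to a feasible \<open>Xs\<close> the residual shrinks linearly from \<open>e\<close> to \<open>0\<close>, so the
  penalty has slope \<open>- lam \<parallel>e\<parallel>\<close>. The subgradient inequality gives \<open>lam \<parallel>e\<parallel> \<le> \<langle>v, e\<rangle>\<close>, and Cauchy--Schwarz
  does the rest.
\<close>

lemma infeasible_multiplier_ge:
  fixes A :: "'k::finite \<Rightarrow> real^'n^'n"
  assumes der: "(f has_derivative (\<lambda>D. G0 \<bullet> D)) (at X within sym_mats)"
    and X: "X \<in> sym_mats" and Xs: "Xs \<in> sym_mats" "meas_map A Xs = b"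
    and G: "G0 + meas_adj A v \<in> sym_subdiff (penalized f A b lam) X"
    and infeas: "meas_map A X \<noteq> b"
  shows "lam \<le> norm v"
proof -
  define e where "e = meas_map A X - b"
  define G where "G = G0 + meas_adj A v"
  have D: "Xs - X \<in> sym_mats" by (rule subspace_diff[OF subspace_sym_mats Xs(1) X])
  have "G \<bullet> (Xs - X) + lam * norm e \<le> G0 \<bullet> (Xs - X)"
  proof (rule directional_derivative_ge[OF der X D])
    fix t :: real assume t: "0 < t" "t < 1"
    have "X + t *\<^sub>R (Xs - X) \<in> sym_mats"
      using X D by (intro subspace_add subspace_scale subspace_sym_mats)
    then have sub: "penalized f A b lam X + G \<bullet> (t *\<^sub>R (Xs - X))
        \<le> penalized f A b lam (X + t *\<^sub>R (Xs - X))"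
      using assms(5) by (force simp: sym_subdiff_def G_def)
    have "meas_map A (X + t *\<^sub>R (Xs - X)) - b = (1 - t) *\<^sub>R e"
      using Xs linear_meas_map[of A]
      by (simp add: e_def linear_add linear_scale linear_diff algebra_simps)
    then have "norm (meas_map A (X + t *\<^sub>R (Xs - X)) - b) = (1 - t) * norm e"
      using t by simp
    from sub[unfolded penalized_def this e_def[symmetric]]
    show "t * (G \<bullet> (Xs - X) + lam * norm e) \<le> f (X + t *\<^sub>R (Xs - X)) - f X"
      unfolding inner_scaleR_right by (simp add: distrib_left left_diff_distrib right_diff_distrib mult_ac)
  qed
  then have "lam * norm e \<le> v \<bullet> e"
    using Xs by (simp add: G_def inner_add_left meas_adj_inner linear_diff[OF linear_meas_map] e_def
        inner_diff_right)
  also have "\<dots> \<le> norm v * norm e" by (rule norm_cauchy_schwarz)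
  finally show ?thesis using infeas by (simp add: e_def)
qed

section \<open>Estimates near the set of factors\<close>

text \<open>
  The two consequences of the decomposition \<open>G = E + Z + \<Sum>\<^sub>i w\<^sub>i A\<^sub>i\<close>, where \<open>E\<close> is a gradient difference
  of order \<open>De\<close> and \<open>w\<close> the deviation of the multiplier from the dual optimum. For the first, \<open>Z Rh = 0\<close> reduces
  \<open>Z R\<close> to \<open>Z De\<close>, so \<open>(\<Sum>\<^sub>i w\<^sub>i A\<^sub>i) R\<close> equals \<open>G R\<close> up to terms of order \<open>De\<close>. For the second, expand around \<open>R\<close>:
  the linear terms only see \<open>G R\<close>, and in the quadratic term \<open>Z\<close> has the favourable sign.
\<close>

lemma multiplier_and_growth_bounds:
  fixes Rh De R :: "real^'r^'n" and A :: "'k::finite \<Rightarrow> real^'n^'n"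
  assumes R: "R = Rh + De" and G: "G = E + Z + meas_adj A w" "G \<in> sym_mats"
    and Z: "psd Z" "Z \<bullet> gram Rh = 0"
    and E: "norm E \<le> c * norm De" and cq: "\<gamma> * norm w \<le> norm (meas_adj A w ** R)"
    and B: "norm R \<le> B" and c0: "0 \<le> c" and a: "norm (meas_adj A w) \<le> a * norm w"
  shows "\<gamma> * norm w \<le> norm (G ** R) + (c * B + norm Z) * norm De"
    and "G \<bullet> (gram R - gram Rh)
      \<le> 2 * norm (G ** R) * norm De + c * norm De ^ 3 + a * norm w * (norm De)\<^sup>2"
proof -
  have "Z ** Rh = 0" by (rule psd_mult_eq_0[OF Z])
  then have "Z ** R = Z ** De" by (simp add: R matrix_add_ldistrib)
  then have "meas_adj A w ** R = G ** R - E ** R - Z ** De"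
    by (simp add: G matrix_add_rdistrib)
  then have "norm (meas_adj A w ** R) \<le> norm (G ** R) + norm (E ** R) + norm (Z ** De)"
    by (metis (no_types, opaque_lifting) add_mono_thms_linordered_semiring(3) norm_triangle_ineq4
        order_trans)
  also have "\<dots> \<le> norm (G ** R) + c * norm De * B + norm Z * norm De"
    using norm_matrix_mult_le[of E R] norm_matrix_mult_le[of Z De]
      mult_mono[OF E B] c0 by (simp add: add_mono)
  finally show "\<gamma> * norm w \<le> norm (G ** R) + (c * B + norm Z) * norm De"
    using cq by (simp add: algebra_simps)
next
  have gDe: "norm (gram De) \<le> (norm De)\<^sup>2"
    using norm_matrix_mult_le[of De "transpose De"]
    by (simp add: gram_def norm_transpose power2_eq_square)
  have tG: "transpose G = G" using G(2) by (simp add: sym_mats_def)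
  have "gram Rh = gram R - (R ** transpose De + De ** transpose R) + gram De"
    using gram_add[of R "- De"] unfolding R
    by (simp add: gram_def transpose_def vec_eq_iff matrix_matrix_mult_def sum_negf)
  then have "G \<bullet> (gram R - gram Rh) = G \<bullet> (R ** transpose De) + G \<bullet> (De ** transpose R) - G \<bullet> gram De"
    by (simp add: inner_add_right inner_diff_right)
  also have "G \<bullet> (R ** transpose De) = (G ** R) \<bullet> De"
  proof -
    have "G \<bullet> (R ** transpose De) = transpose G \<bullet> transpose (R ** transpose De)"
      by (simp add: inner_transpose)
    also have "\<dots> = G \<bullet> (De ** transpose R)" by (simp add: tG matrix_transpose_mul)
    finally show ?thesis by (simp add: inner_matrix_mult_right)
  qed
  also have "G \<bullet> (De ** transpose R) = (G ** R) \<bullet> De" by (simp add: inner_matrix_mult_right)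
  finally have "G \<bullet> (gram R - gram Rh) = 2 * ((G ** R) \<bullet> De) - G \<bullet> gram De" by simp
  moreover have "(G ** R) \<bullet> De \<le> norm (G ** R) * norm De" by (rule norm_cauchy_schwarz)
  moreover have "- (G \<bullet> gram De) \<le> - (E \<bullet> gram De) - meas_adj A w \<bullet> gram De"
    using psd_inner_gram_nonneg[OF Z(1), of De] by (simp add: G inner_add_left)
  moreover have "- (E \<bullet> gram De) \<le> c * norm De * (norm De)\<^sup>2"
    using Cauchy_Schwarz_ineq2[of E "gram De"] mult_mono[OF E gDe] c0 by simp
  moreover have "- (meas_adj A w \<bullet> gram De) \<le> a * norm w * (norm De)\<^sup>2"
    using Cauchy_Schwarz_ineq2[of "meas_adj A w" "gram De"] mult_mono[OF a gDe]
      order_trans[OF norm_ge_zero a] by simp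
  ultimately show "G \<bullet> (gram R - gram Rh)
      \<le> 2 * norm (G ** R) * norm De + c * norm De ^ 3 + a * norm w * (norm De)\<^sup>2"
    by (simp add: power2_eq_square power3_eq_cube mult.assoc)
qed

text \<open>
  Reduces a bound on the distance from \<open>0\<close> to a subdifferential to bounds on its elements, which need
  not attain the distance.
\<close>

lemma le_infdist:
  assumes "S \<noteq> {}" "0 \<le> k" "\<And>d. d \<in> S \<Longrightarrow> a \<le> k * norm d"
  shows "a \<le> k * infdist 0 S"
proof (cases "k = 0")
  case True
  with assms show ?thesis by auto
next
  case False
  with assms(2) have k: "k > 0" by simp
  have "a / k \<le> dist 0 d" if "d \<in> S" for d
    using assms(3)[OF that] k by (simp add: field_simps)
  then have "a / k \<le> infdist 0 S"
    using assms(1) by (simp add: infdist_notempty cINF_greatest)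
  then show ?thesis using k by (simp add: field_simps)
qed

lemma gram_diff_norm_le:
  fixes R Rh :: "real^'r^'n"
  assumes "norm R \<le> B" "norm Rh \<le> B"
  shows "norm (gram R - gram Rh) \<le> 2 * B * norm (R - Rh)"
proof -
  have "gram R - gram Rh = R ** transpose (R - Rh) + (R - Rh) ** transpose Rh"
    by (simp add: gram_def transpose_diff matrix_diff_ldistrib matrix_diff_rdistrib)
  then have "norm (gram R - gram Rh)
      \<le> norm R * norm (transpose (R - Rh)) + norm (R - Rh) * norm (transpose Rh)"
    by (metis add_mono norm_matrix_mult_le norm_triangle_le)
  also have "\<dots> \<le> B * norm (R - Rh) + norm (R - Rh) * B"
    unfolding norm_transpose using assms order_trans[OF norm_ge_zero assms(1)]
    by (intro add_mono mult_mono) auto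
  finally show ?thesis by simp
qed

text \<open>
  Lipschitz control with one end fixed at \<open>x\<close>, which is what differentiability at \<open>x\<close> provides.
\<close>

lemma has_derivative_locally_lipschitz_at:
  assumes "(g has_derivative g') (at x within S)"
  obtains \<epsilon> c where "0 < \<epsilon>" "0 \<le> c"
    "\<And>y. y \<in> S \<Longrightarrow> norm (y - x) < \<epsilon> \<Longrightarrow> norm (g y - g x) \<le> c * norm (y - x)"
proof -
  have lin: "bounded_linear g'"
    and "\<forall>e>0. \<exists>d>0. \<forall>y\<in>S. norm (y - x) < d \<longrightarrow> norm (g y - g x - g' (y - x)) \<le> e * norm (y - x)"
    using assms by (auto simp: has_derivative_within_alt)
  then obtain d where d: "d > 0"
    "\<And>y. y \<in> S \<Longrightarrow> norm (y - x) < d \<Longrightarrow> norm (g y - g x - g' (y - x)) \<le> 1 * norm (y - x)"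
    using zero_less_one by blast
  have "norm (g y - g x) \<le> (1 + onorm g') * norm (y - x)" if "y \<in> S" "norm (y - x) < d" for y
    using d(2)[OF that] onorm[OF lin, of "y - x"]
      norm_triangle_ineq[of "g y - g x - g' (y - x)" "g' (y - x)"]
    by (simp add: distrib_right)
  with that[of d "1 + onorm g'"] d(1) onorm_pos_le[OF lin] show ?thesis by simp
qed

text \<open>
  The scalar part of the argument: \<open>\<delta>\<close> is the distance to the factor set, \<open>D\<close> the norm of a
  subgradient, \<open>\<Psi>\<close> the gap of the objective and \<open>m = \<sigma>\<^sup>2 \<alpha>\<close>. The two alternatives in \<open>lower\<close> are the feasible and
  the infeasible case. The smallness conditions give \<open>\<Psi> \<le> 2 D \<delta> + m \<delta>\<^sup>2 / 8\<close>; in the feasible case this is compared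
  with \<open>m \<delta>\<^sup>2 / 2\<close>, in the infeasible case \<open>D \<ge> \<gamma> / 2 \<ge> m \<delta> / 8\<close>. The resulting bound \<open>m \<delta> \<le> 8 D\<close> turns
  \<open>m \<delta>\<^sup>2 / 8\<close> into at most \<open>D \<delta>\<close>.
\<close>

lemma absorb_higher_order_terms:
  fixes \<delta> D \<Psi> m C4 C5 C2 \<gamma> :: real
  assumes "0 \<le> \<delta>" "0 \<le> D" "0 < m"
    and upper: "\<Psi> \<le> D * \<delta> + C4 * \<delta> ^ 3 + C5 * D * \<delta>\<^sup>2"
    and lower: "m / 2 * \<delta>\<^sup>2 \<le> \<Psi> \<or> \<gamma> \<le> D + C2 * \<delta>"
    and small: "C4 * \<delta> \<le> m / 8" "C5 * \<delta> \<le> 1" "C2 * \<delta> \<le> \<gamma> / 2" "m * \<delta> \<le> 4 * \<gamma>"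
  shows "\<delta> \<le> 8 / m * D" and "\<Psi> \<le> 4 * \<delta> * D"
proof -
  have "C4 * \<delta> ^ 3 = (C4 * \<delta>) * \<delta>\<^sup>2" by (simp add: power2_eq_square power3_eq_cube)
  also have "\<dots> \<le> m / 8 * \<delta>\<^sup>2" using small(1) by (intro mult_right_mono) auto
  finally have cubic: "C4 * \<delta> ^ 3 \<le> m / 8 * \<delta>\<^sup>2" .
  have "C5 * D * \<delta>\<^sup>2 = (C5 * \<delta>) * (D * \<delta>)" by (simp add: power2_eq_square)
  also have "\<dots> \<le> 1 * (D * \<delta>)" using small(2) assms(1,2) by (intro mult_right_mono) auto
  finally have upper': "\<Psi> \<le> 2 * (D * \<delta>) + m / 8 * \<delta>\<^sup>2" using upper cubic by simp
  show reg: "\<delta> \<le> 8 / m * D"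
    using lower
  proof
    assume "m / 2 * \<delta>\<^sup>2 \<le> \<Psi>"
    then have "(3 * m / 8 * \<delta>) * \<delta> \<le> (2 * D) * \<delta>" using upper' by (simp add: power2_eq_square)
    then have "\<delta> = 0 \<or> 3 * m / 8 * \<delta> \<le> 2 * D"
      using mult_right_le_imp_le[of "3 * m / 8 * \<delta>" \<delta> "2 * D"] assms(1) by linarith
    then have "m * \<delta> \<le> 8 * D" using assms by auto
    then show ?thesis using assms(3) by (simp add: field_simps)
  next
    assume "\<gamma> \<le> D + C2 * \<delta>"
    then have "m * \<delta> \<le> 8 * D" using small by simp
    then show ?thesis using assms(3) by (simp add: field_simps)
  qed
  have "m / 8 * \<delta>\<^sup>2 \<le> D * \<delta>"
    using mult_right_mono[OF reg assms(1)] assms(3) by (simp add: power2_eq_square field_simps)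
  then have "\<Psi> \<le> 3 * (D * \<delta>)" using upper' by simp
  also have "\<dots> \<le> 4 * \<delta> * D" using mult_nonneg_nonneg[OF assms(1,2)] by (simp add: mult.commute)
  finally show "\<Psi> \<le> 4 * \<delta> * D" .
qed

lemma eventually_mult_less:
  fixes K c :: real
  assumes "0 < c"
  shows "\<forall>\<^sub>F \<delta> in nhds 0. K * \<delta> < c"
proof (rule order_tendstoD(2))
  show "((\<lambda>\<delta>. K * \<delta>) \<longlongrightarrow> K * 0) (nhds 0)" by (intro tendsto_intros filterlim_ident)
qed (use assms in simp)

section \<open>Norm convexity and subdifferential regularity\<close>

theorem theorem3:
  fixes f :: "real^'n^'n \<Rightarrow> real"
    and g :: "real^'n^'n \<Rightarrow> real^'n^'n"
    and H :: "real^'n^'n \<Rightarrow> real^'n^'n \<Rightarrow> real^'n^'n"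
    and A :: "'k::finite \<Rightarrow> real^'n^'n"
    and b :: "real^'k"
    and Rs :: "real^'r^'n"
    and Xs :: "real^'n^'n"
    and \<alpha> \<beta> \<rho> L :: real
  assumes "\<And>i. A i \<in> sym_mats"
    and "convex_on sym_mats f"
    and "Xs = gram Rs"
    and "rank Rs = CARD('r)"
    and "\<And>X. is_arg_min f (feasible A b) X \<longleftrightarrow> X = Xs"
    and "smoothness f g H Xs \<beta> \<rho> L"
    and "dual_optimum A g Xs"
    and "\<alpha> > 0"
    and "quadratic_growth CARD('r) f A b Xs \<alpha>"
    and "constraint_qualification TYPE('r) A b Xs"
  shows "\<exists>l < 5. \<exists>l' < 2 * (sqrt 2 + 1) * l / ((singular_value CARD('r) Rs)\<^sup>2 * \<alpha>).
    \<forall>\<^sub>F lam in at_top. \<exists>U :: (real^'r^'n) set. open U \<and> factor_set Xs \<subseteq> U \<and>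
      (\<forall>R\<in>U.
        objective f A b lam R - f Xs
          \<le> l * infdist 0 (objective_subdiff f A b lam R) * infdist R (factor_set Xs) \<and>
        infdist R (factor_set Xs) \<le> l' * infdist 0 (objective_subdiff f A b lam R))"
proof -
  define S :: "(real^'r^'n) set" where "S = factor_set Xs"
  have S_iff: "R \<in> S \<longleftrightarrow> gram R = Xs" for R by (simp add: S_def factor_set_def)
  have "Rs \<in> S" using assms(3) by (simp add: S_iff)
  define \<sigma> where "\<sigma> = singular_value CARD('r) Rs"
  have \<sigma>: "0 < \<sigma>" unfolding \<sigma>_def by (rule singular_value_pos[OF assms(4)])
  define m where "m = \<sigma>\<^sup>2 * \<alpha>"
  have m: "0 < m" using \<sigma> assms(8) by (simp add: m_def)

  have feas: "feasible A b Xs" using assms(5)[of Xs] by (simp add: is_arg_min_def)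
  then have Xs: "Xs \<in> sym_mats" "meas_map A Xs = b" by (auto simp: feasible_def psd_def)
  have C2: "C2_sym f g H" using assms(6) by (simp add: smoothness_def)
  have g_sym: "g X \<in> sym_mats"
    and f_der: "(f has_derivative (\<lambda>D. g X \<bullet> D)) (at X within sym_mats)"
    and g_der: "(g has_derivative H X) (at X within sym_mats)" if "X \<in> sym_mats" for X
    using C2 that by (auto simp: C2_sym_def)
  obtain y :: "real^'k" and Z where Z: "psd Z" "Z \<bullet> Xs = 0" and gXs: "g Xs = Z - meas_adj A y"
    using assms(7) unfolding dual_optimum_def meas_adj_def[symmetric]
    by (metis add_diff_cancel_right' eq_iff_diff_eq_0)
  obtain \<epsilon>q where \<epsilon>q: "0 < \<epsilon>q" and growth: "\<And>X. feasible A b X \<Longrightarrow> rank X \<le> CARD('r) \<Longrightarrow>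
      norm (X - Xs) \<le> \<epsilon>q \<Longrightarrow> f Xs + \<alpha> / 2 * (norm (X - Xs))\<^sup>2 \<le> f X"
    using assms(9) by (auto simp: quadratic_growth_def)
  obtain \<gamma> W where \<gamma>: "0 < \<gamma>" and W: "open W" "S \<subseteq> W"
    and cq: "\<And>R. R \<in> W \<Longrightarrow> \<gamma> \<le> singular_value CARD('k) (cq_matrix A R)"
    using assms(10) by (auto simp: constraint_qualification_def S_def)
  have cptS: "compact S" unfolding S_def by (rule compact_factor_set)
  obtain \<epsilon>W where \<epsilon>W: "0 < \<epsilon>W" "(\<Union>R\<in>S. ball R \<epsilon>W) \<subseteq> W"
    using compact_subset_open_imp_ball_epsilon_subset[OF cptS W] .
  obtain \<epsilon>g cg where \<epsilon>g: "0 < \<epsilon>g" and cg: "0 \<le> cg"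
    and g_lip: "\<And>X. X \<in> sym_mats \<Longrightarrow> norm (X - Xs) < \<epsilon>g \<Longrightarrow> norm (g X - g Xs) \<le> cg * norm (X - Xs)"
    using has_derivative_locally_lipschitz_at[OF g_der[OF Xs(1)]] by metis
  obtain a where a: "\<And>w. norm (meas_adj A w) \<le> a * norm w"
    using linear_bounded[OF linear_meas_adj] by blast

  define B where "B = norm Rs + 1"
  define c where "c = cg * (2 * B)"
  define K where "K = c * B + norm Z"
  define C4 where "C4 = c + \<bar>a\<bar> * K / \<gamma>"
  define C5 where "C5 = \<bar>a\<bar> / \<gamma>"
  have B: "0 < B" by (simp add: B_def add_nonneg_pos)
  have c: "0 \<le> c" using cg B by (simp add: c_def)
  have a': "norm (meas_adj A w) \<le> \<bar>a\<bar> * norm w" for w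
    using a[of w] mult_right_mono[OF abs_ge_self[of a] norm_ge_zero[of w]] by linarith

  \<comment> \<open>Every smallness condition has the form \<open>const * \<delta> < bound\<close> and involves no penalty parameter, so one
       neighborhood serves all large \<open>lam\<close>.\<close>
  have "\<forall>\<^sub>F \<delta> in nhds 0. 1 * \<delta> < 1 \<and> 1 * \<delta> < \<epsilon>W \<and> (2 * B) * \<delta> < \<epsilon>g \<and> (2 * B) * \<delta> < \<epsilon>q
      \<and> 1 * \<delta> < 2 / 5 * \<sigma> \<and> C4 * \<delta> < m / 8 \<and> C5 * \<delta> < 1 \<and> K * \<delta> < \<gamma> / 2 \<and> m * \<delta> < 4 * \<gamma>"
    using \<epsilon>W(1) \<epsilon>g \<epsilon>q \<sigma> m \<gamma> by (intro eventually_conj eventually_mult_less) auto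
  then obtain \<epsilon> where \<epsilon>: "0 < \<epsilon>" and near: "\<forall>\<delta>. dist \<delta> 0 < \<epsilon> \<longrightarrow> 1 * \<delta> < 1 \<and> 1 * \<delta> < \<epsilon>W
      \<and> (2 * B) * \<delta> < \<epsilon>g \<and> (2 * B) * \<delta> < \<epsilon>q \<and> 1 * \<delta> < 2 / 5 * \<sigma>
      \<and> C4 * \<delta> < m / 8 \<and> C5 * \<delta> < 1 \<and> K * \<delta> < \<gamma> / 2 \<and> m * \<delta> < 4 * \<gamma>"
    unfolding eventually_nhds_metric by (elim exE conjE)
  have small: "\<delta> < 1 \<and> \<delta> < \<epsilon>W \<and> (2 * B) * \<delta> < \<epsilon>g \<and> (2 * B) * \<delta> < \<epsilon>q \<and> \<delta> < 2 / 5 * \<sigma>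
      \<and> C4 * \<delta> < m / 8 \<and> C5 * \<delta> < 1 \<and> K * \<delta> < \<gamma> / 2 \<and> m * \<delta> < 4 * \<gamma>"
    if "0 \<le> \<delta>" "\<delta> < \<epsilon>" for \<delta>
    using near[rule_format, of \<delta>] that by (simp add: dist_real_def)

  define U where "U = {R. infdist R S < \<epsilon>}"
  have "open U" unfolding U_def by (intro open_Collect_less continuous_intros)
  have "S \<subseteq> U" using \<epsilon> by (auto simp: U_def)

  have main: "objective f A b lam R - f Xs
          \<le> 4 * infdist 0 (objective_subdiff f A b lam R) * infdist R S \<and>
        infdist R S \<le> 8 / m * infdist 0 (objective_subdiff f A b lam R)"
    if lam: "norm y + 1 \<le> lam" and R: "R \<in> U" for lam R
  proof -
    define \<delta> where "\<delta> = infdist R S"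
    have \<delta>: "0 \<le> \<delta>" "\<delta> < \<epsilon>" using R by (auto simp: \<delta>_def U_def infdist_nonneg)
    note sm = small[OF \<delta>]
    have "S \<noteq> {}" using \<open>Rs \<in> S\<close> by blast
    then obtain Rh where Rh: "Rh \<in> S" and "infdist R S = dist R Rh"
      by (rule infdist_attains_inf[OF compact_imp_closed[OF cptS], of R])
    then have dist: "norm (R - Rh) = \<delta>" by (simp add: \<delta>_def dist_norm)
    define De where "De = R - Rh"
    have RDe: "R = Rh + De" and nDe: "norm De = \<delta>" using dist by (auto simp: De_def)
    have gRh: "gram Rh = Xs" using Rh by (simp add: S_iff)
    have nRh: "norm Rh = norm Rs" using gRh assms(3) by (intro norm_factor_eq) simp
    have nR: "norm R \<le> B" "norm Rh \<le> B"
      using norm_triangle_ineq[of Rh De] sm nDe nRh by (auto simp: B_def RDe)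
    define X where "X = gram R"
    have X: "X \<in> sym_mats" unfolding X_def by (rule gram_sym)
    have XXs: "norm (X - Xs) \<le> (2 * B) * \<delta>"
      using gram_diff_norm_le[OF nR] by (simp add: X_def gRh dist)
    \<comment> \<open>The constraint qualification is used at \<open>R\<close> itself, since \<open>d\<close> controls \<open>G ** R\<close>.\<close>
    have "R \<in> ball Rh \<epsilon>W" using dist sm by (simp add: dist_norm norm_minus_commute)
    then have RW: "R \<in> W" using \<epsilon>W(2) Rh by blast
    have cqR: "\<gamma> * norm w \<le> norm (meas_adj A w ** R)" for w
      using order_trans[OF mult_right_mono[OF cq[OF RW] norm_ge_zero] cq_matrix_bound] .
    have far: "\<sigma> * \<delta> \<le> norm (X - Xs)"
    proof -
      have "norm (R - Rh) \<le> norm (R - R')" if "gram R' = gram Rh" for R'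
        using that infdist_le[of R' S R] gRh unfolding dist \<delta>_def by (simp add: S_iff dist_norm)
      then have "transpose (transpose Rh ** De) = transpose Rh ** De"
        unfolding De_def by (rule nearest_factor_symmetric)
      moreover have "\<sigma> * norm v \<le> norm (Rh *v v)" for v
        unfolding \<sigma>_def using gRh assms(3,4) by (intro factor_set_singular_value_bound) auto
      ultimately have "sqrt 2 * \<sigma> * \<delta> - \<delta>\<^sup>2 \<le> norm (X - Xs)"
        using gram_expansion_lower_bound[of Rh De \<sigma>] \<sigma> by (simp add: X_def RDe nDe gRh)
      \<comment> \<open>The margin \<open>sqrt 2 - 1 \<ge> 2/5\<close> absorbs the quadratic term, as \<open>\<delta> < 2/5 * \<sigma>\<close>.\<close>
      moreover have "7 / 5 \<le> sqrt 2" by (rule real_le_rsqrt) (simp add: power2_eq_square)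
      then have "7 / 5 * (\<sigma> * \<delta>) \<le> sqrt 2 * (\<sigma> * \<delta>)"
        using \<sigma> \<delta> by (intro mult_right_mono) auto
      moreover have "\<delta>\<^sup>2 \<le> 2 / 5 * (\<sigma> * \<delta>)"
        using mult_right_mono[of \<delta> "2 / 5 * \<sigma>" \<delta>] sm \<delta> by (simp add: power2_eq_square)
      ultimately show ?thesis by simp
    qed
    define \<Psi> where "\<Psi> = objective f A b lam R - f Xs"
    have each: "\<delta> \<le> 8 / m * norm d \<and> \<Psi> \<le> 4 * \<delta> * norm d"
      if d: "d \<in> objective_subdiff f A b lam R" for d
    proof -
      obtain G where G: "G \<in> sym_subdiff (penalized f A b lam) X" and dG: "d = 2 *\<^sub>R (G ** R)"
        using d by (auto simp: objective_subdiff_def X_def)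
      obtain v where v: "G = g X + meas_adj A v"
        using sym_subdiff_penalized_representation[OF assms(1) f_der[OF X] X g_sym[OF X] G] .
      define w where "w = v - y"
      define E where "E = g X - g Xs"
      have GE: "G = E + Z + meas_adj A w"
        by (simp add: v E_def w_def gXs linear_diff[OF linear_meas_adj])
      have Gs: "G \<in> sym_mats" using G by (simp add: sym_subdiff_def)
      have "norm E \<le> cg * norm (X - Xs)" unfolding E_def using XXs sm by (intro g_lip X) auto
      also have "\<dots> \<le> cg * ((2 * B) * \<delta>)" by (intro mult_left_mono XXs cg)
      finally have E: "norm E \<le> c * norm De" by (simp add: c_def nDe mult.assoc)
      have ZRh: "Z \<bullet> gram Rh = 0" using Z(2) gRh by simp
      note est = multiplier_and_growth_bounds[OF RDe GE Gs Z(1) ZRh E cqR nR(1) c a']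
      have D: "norm (G ** R) = norm d / 2" by (simp add: dG)
      have w_le: "\<gamma> * norm w \<le> norm d + K * \<delta>"
        using est(1) norm_ge_zero[of d] unfolding D nDe K_def by linarith
      have "\<Psi> \<le> G \<bullet> (gram R - gram Rh)"
        using G Xs unfolding sym_subdiff_def \<Psi>_def objective_def X_def[symmetric] gRh
        by (force simp: penalized_def inner_diff_right)
      then have "\<Psi> \<le> norm d * \<delta> + c * \<delta> ^ 3 + \<bar>a\<bar> * norm w * \<delta>\<^sup>2"
        using est(2) by (simp add: D nDe)
      also have "\<bar>a\<bar> * norm w * \<delta>\<^sup>2 \<le> \<bar>a\<bar> * ((norm d + K * \<delta>) / \<gamma>) * \<delta>\<^sup>2"
        using w_le \<gamma> by (intro mult_right_mono mult_left_mono) (auto simp: field_simps)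
      finally have upper: "\<Psi> \<le> norm d * \<delta> + C4 * \<delta> ^ 3 + C5 * norm d * \<delta>\<^sup>2"
        by (simp add: C4_def C5_def power2_eq_square power3_eq_cube algebra_simps add_divide_distrib)
      have lower: "m / 2 * \<delta>\<^sup>2 \<le> \<Psi> \<or> \<gamma> \<le> norm d + K * \<delta>"
      proof (cases "meas_map A X = b")
        case True
        have "rank X \<le> CARD('r)"
          using rank_mul_le_left[of R "transpose R"] rank_bound[of R]
          by (simp add: X_def gram_def)
        moreover have "feasible A b X" using True psd_gram[of R] by (simp add: feasible_def X_def)
        ultimately have "\<alpha> / 2 * (norm (X - Xs))\<^sup>2 \<le> \<Psi>"
          using growth[of X] XXs sm True
          by (simp add: \<Psi>_def objective_def penalized_def X_def)
        moreover have "\<alpha> / 2 * (\<sigma> * \<delta>)\<^sup>2 \<le> \<alpha> / 2 * (norm (X - Xs))\<^sup>2"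
          using far \<sigma> \<delta> assms(8) by (intro mult_left_mono power_mono) auto
        moreover have "m / 2 * \<delta>\<^sup>2 = \<alpha> / 2 * (\<sigma> * \<delta>)\<^sup>2" by (simp add: m_def power_mult_distrib)
        ultimately show ?thesis by simp
      next
        case False
        have "lam \<le> norm v"
          using infeasible_multiplier_ge[OF f_der[OF X] X Xs _ False] G v by simp
        then have "1 \<le> norm w" using lam norm_triangle_ineq2[of v y] by (simp add: w_def)
        then have "\<gamma> \<le> \<gamma> * norm w" using \<gamma> by simp
        then show ?thesis using w_le by simp
      qed
      show ?thesis
        using absorb_higher_order_terms[OF \<delta>(1) norm_ge_zero m upper lower] sm by simp
    qed
    have "lam \<ge> 0" using lam norm_ge_zero[of y] by linarith
    then have ne: "objective_subdiff f A b lam R \<noteq> {}"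
      using sym_subdiff_penalized_nonempty[OF assms(1,2) f_der[OF X] X g_sym[OF X], where lam = lam and b = b]
      by (simp add: objective_subdiff_def X_def)
    have "\<delta> \<le> 8 / m * infdist 0 (objective_subdiff f A b lam R)"
      using each m by (intro le_infdist[OF ne]) auto
    moreover have "\<Psi> \<le> 4 * \<delta> * infdist 0 (objective_subdiff f A b lam R)"
      using each \<delta> by (intro le_infdist[OF ne]) auto
    ultimately show ?thesis by (simp add: \<delta>_def \<Psi>_def mult_ac)
  qed

  have "1 < sqrt (2 :: real)" by simp
  then have "8 / m < 2 * (sqrt 2 + 1) * 4 / m" using m by (simp add: divide_strict_right_mono)
  moreover have "\<forall>\<^sub>F lam in at_top. \<exists>U. open U \<and> S \<subseteq> U \<and> (\<forall>R\<in>U.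
        objective f A b lam R - f Xs
          \<le> 4 * infdist 0 (objective_subdiff f A b lam R) * infdist R S \<and>
        infdist R S \<le> 8 / m * infdist 0 (objective_subdiff f A b lam R))"
    using eventually_ge_at_top[of "norm y + 1"]
  proof eventually_elim
    case (elim lam)
    then show ?case using \<open>open U\<close> \<open>S \<subseteq> U\<close> main by blast
  qed
  ultimately show ?thesis
    unfolding S_def[symmetric] \<sigma>_def[symmetric] m_def[symmetric]
    by (intro exI[of _ 4] exI[of _ "8 / m"] conjI) auto
qed

end
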